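(* Let $B$ be a unital $C^*$-algebra and let $S\subset B$ be an operator system with $C^*(S)=B$. Assume that the matrix state space of $S$ is a free spectrahedron $\mathcal{D}_A$ satisfying $\mathcal{D}_A(2)^\dagger=\mathcal{D}_A(2)$. Then any pure state on $S$ admits a unique extension to a state on $B$, and this extension is a $*$-representation. In particular, $S$ has the pure extension property in $B$.
   Context: An operator system in $B$ is a self-adjoint subspace containing the unit. States on $S$ are unital contractive linear functionals on $S$; pure states are extreme points of the set of states. $S$ has the pure extension property in $B$ if every pure state on $S$ admits a unique extension to a state on $B$. Matrix state space: for $n\ge1$, $\mathcal{W}_n(S)$ is the set of unital completely positive maps $S\to\mathbb{M}_n$ (complex $n\times n$ matrices), and $\mathcal{W}(S)=(\mathcal{W}_n(S))_n$ is the matrix state space of $S$, a matrix convex set in the dual of $S$. Free spectrahedron: fix integers $d,g\ge1$ and self-adjoint $A_1,\dots,A_g\in\mathbb{M}_d$, and put $A=(A_1,\dots,A_g)$. For $n\ge1$, $\mathcal{D}_A(n)\subset(\mathbb{M}_n)^g$ is the set of $g$-tuples $(X_1,\dots,X_g)$ of self-adjoint $n\times n$ matrices with $\sum_{k=1}^g A_k\otimes X_k\le I$. The sequence $\mathcal{D}_A=(\mathcal{D}_A(n))_n$ is the free spectrahedron corresponding to $A$, a matrix convex set in $\mathbb{C}^g$. That the matrix state space of $S$ "is" $\mathcal{D}_A$ is understood as an identification of matrix convex sets: there are homeomorphisms $\theta_n:\mathcal{W}_n(S)\to\mathcal{D}_A(n)$, $n\ge1$ (for the point-norm topology on $\mathcal{W}_n(S)$),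 such that $(\theta_n)_n$ preserves matrix convex combinations, i.e. $\theta_n(\sum_i v_i^*\psi_i v_i)=\sum_i v_i^*\theta_{n_i}(\psi_i)v_i$ for finite families $\psi_i\in\mathcal{W}_{n_i}(S)$ and $n_i\times n$ matrices $v_i$ with $\sum_i v_i^*v_i=I$. For $X=[x_{ij}]\in\mathbb{M}_n$, let $X^\dagger=[\overline{x_{ij}}]$ (entrywise complex conjugate), and $\mathcal{D}_A(n)^\dagger=\{(X_1^\dagger,\dots,X_g^\dagger):(X_1,\dots,X_g)\in\mathcal{D}_A(n)\}$. *)

theory Defs
  imports "HOL-Analysis.Analysis" "Jordan_Normal_Form.Schur_Decomposition"
begin

section \<open>Unital C*-algebras\<close>

text \<open>
  The superclass \<^class>\<open>real_normed_algebra_1\<close> requires \<open>norm 1 = 1\<close>; in a C*-algebra this only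
  excludes the zero algebra, which has no states.
\<close>

class unital_cstar_algebra = real_normed_algebra_1 + banach +
  fixes scaleC :: "complex \<Rightarrow> 'a \<Rightarrow> 'a"  (infixr \<open>*\<^sub>C\<close> 75)
    and star :: "'a \<Rightarrow> 'a"
  assumes scaleC_add_right: "c *\<^sub>C (x + y) = c *\<^sub>C x + c *\<^sub>C y"
    and scaleC_add_left: "(c + d) *\<^sub>C x = c *\<^sub>C x + d *\<^sub>C x"
    and scaleC_scaleC: "c *\<^sub>C (d *\<^sub>C x) = (c * d) *\<^sub>C x"
    and scaleR_scaleC: "scaleR r x = complex_of_real r *\<^sub>C x"
    and mult_scaleC_left: "(c *\<^sub>C x) * y = c *\<^sub>C (x * y)"
    and mult_scaleC_right: "x * (c *\<^sub>C y) = c *\<^sub>C (x * y)"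
    and norm_scaleC: "norm (c *\<^sub>C x) = cmod c * norm x"
    and star_star: "star (star x) = x"
    and star_add: "star (x + y) = star x + star y"
    and star_scaleC: "star (c *\<^sub>C x) = cnj c *\<^sub>C star x"
    and star_mult: "star (x * y) = star y * star x"
    and cstar_identity: "norm (star x * x) = (norm x)\<^sup>2"

definition complex_subspace :: "'b::unital_cstar_algebra set \<Rightarrow> bool" where
  "complex_subspace S \<longleftrightarrow>
     0 \<in> S \<and> (\<forall>x\<in>S. \<forall>y\<in>S. x + y \<in> S) \<and> (\<forall>c. \<forall>x\<in>S. c *\<^sub>C x \<in> S)"

definition operator_system :: "'b::unital_cstar_algebra set \<Rightarrow> bool" where
  "operator_system S \<longleftrightarrow> complex_subspace S \<and> (\<forall>x\<in>S. star x \<in> S) \<and> 1 \<in> S"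

definition cstar_subalgebra :: "'b::unital_cstar_algebra set \<Rightarrow> bool" where
  "cstar_subalgebra D \<longleftrightarrow> complex_subspace D \<and> (\<forall>x\<in>D. \<forall>y\<in>D. x * y \<in> D)
     \<and> (\<forall>x\<in>D. star x \<in> D) \<and> closed D"

definition generated_cstar :: "'b::unital_cstar_algebra set \<Rightarrow> 'b set" where
  "generated_cstar S = \<Inter>{D. cstar_subalgebra D \<and> S \<subseteq> D}"


section \<open>States and pure states\<close>

text \<open>
  Maps on \<open>S\<close> are represented extensionally (\<^const>\<open>undefined\<close> off \<open>S\<close>), so that equality of HOL
  functions is equality of maps on \<open>S\<close>. For \<open>S = UNIV\<close> this is no restriction.
\<close>

definition states :: "'b::unital_cstar_algebra set \<Rightarrow> ('b \<Rightarrow> complex) set" where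
  "states S = {f \<in> extensional S.
     (\<forall>x\<in>S. \<forall>y\<in>S. f (x + y) = f x + f y) \<and> (\<forall>c. \<forall>x\<in>S. f (c *\<^sub>C x) = c * f x) \<and>
     f 1 = 1 \<and> (\<forall>x\<in>S. cmod (f x) \<le> norm x)}"

definition pure_states :: "'b::unital_cstar_algebra set \<Rightarrow> ('b \<Rightarrow> complex) set" where
  "pure_states S = {\<omega> \<in> states S. \<forall>f\<in>states S. \<forall>g\<in>states S. \<forall>t::real.
     0 < t \<and> t < 1 \<and> (\<forall>x\<in>S. \<omega> x = complex_of_real (1 - t) * f x + complex_of_real t * g x)
     \<longrightarrow> f = \<omega> \<and> g = \<omega>}"

definition state_extension ::
    "'b::unital_cstar_algebra set \<Rightarrow> ('b \<Rightarrow> complex) \<Rightarrow> ('b \<Rightarrow> complex) \<Rightarrow> bool" where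
  "state_extension S \<omega> \<phi> \<longleftrightarrow> \<phi> \<in> states UNIV \<and> (\<forall>x\<in>S. \<phi> x = \<omega> x)"

definition pure_extension_property :: "'b::unital_cstar_algebra set \<Rightarrow> bool" where
  "pure_extension_property S \<longleftrightarrow> (\<forall>\<omega>\<in>pure_states S. \<exists>!\<phi>. state_extension S \<omega> \<phi>)"

text \<open>Unital *-representations of the whole algebra on the one-dimensional Hilbert space.\<close>

definition star_representation :: "('b::unital_cstar_algebra \<Rightarrow> complex) \<Rightarrow> bool" where
  "star_representation \<phi> \<longleftrightarrow>
     (\<forall>x y. \<phi> (x + y) = \<phi> x + \<phi> y) \<and> (\<forall>c x. \<phi> (c *\<^sub>C x) = c * \<phi> x) \<and>
     (\<forall>x y. \<phi> (x * y) = \<phi> x * \<phi> y) \<and> (\<forall>x. \<phi> (star x) = cnj (\<phi> x)) \<and> \<phi> 1 = 1"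


section \<open>Matrices\<close>

definition hermitian_mat :: "complex mat \<Rightarrow> bool" where
  "hermitian_mat M \<longleftrightarrow> mat_adjoint M = M"

text \<open>
  In the order on \<^typ>\<open>complex\<close>, \<open>0 \<le> z\<close> says that \<open>z\<close> is real and nonnegative; hence the
  condition below already forces \<open>M\<close> to be hermitian.
\<close>

definition psd_mat :: "nat \<Rightarrow> complex mat \<Rightarrow> bool" where
  "psd_mat n M \<longleftrightarrow> M \<in> carrier_mat n n \<and> (\<forall>v\<in>carrier_vec n. 0 \<le> (M *\<^sub>v v) \<bullet>c v)"

text \<open>
  The adjoint in \<open>M\<^sub>k(B)\<close>, and the positive elements of the C*-algebra \<open>M\<^sub>k(B)\<close>, i.e. those of
  the form \<open>Y\<^sup>*Y\<close>. (The library's \<^const>\<open>mat_adjoint\<close> is for matrices over fields.)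
\<close>

definition star_mat :: "'b::unital_cstar_algebra mat \<Rightarrow> 'b mat" where
  "star_mat Y = map_mat star (transpose_mat Y)"

definition positive_mat :: "nat \<Rightarrow> 'b::unital_cstar_algebra mat \<Rightarrow> bool" where
  "positive_mat k X \<longleftrightarrow> (\<exists>Y\<in>carrier_mat k k. X = star_mat Y * Y)"

definition mat_sum :: "nat \<Rightarrow> nat \<Rightarrow> (nat \<Rightarrow> complex mat) \<Rightarrow> nat set \<Rightarrow> complex mat" where
  "mat_sum r c F I = mat r c (\<lambda>p. \<Sum>i\<in>I. F i $$ p)"

text \<open>The Kronecker product of a \<open>d \<times> d\<close> and an \<open>n \<times> n\<close> matrix, indexed by pairs
  \<open>(i, p) \<mapsto> i * n + p\<close> with \<open>i < d\<close> and \<open>p < n\<close>.\<close>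

definition kronecker :: "nat \<Rightarrow> nat \<Rightarrow> complex mat \<Rightarrow> complex mat \<Rightarrow> complex mat" where
  "kronecker d n A X = mat (d * n) (d * n)
     (\<lambda>(i, j). A $$ (i div n, j div n) * X $$ (i mod n, j mod n))"

text \<open>The usual (entrywise) topology on \<open>M\<^sub>n\<close>. Entries outside the range \<open>i, j < n\<close> are
  meaningless in the type of matrices, hence the restriction.\<close>

definition mat_topology :: "nat \<Rightarrow> complex mat topology" where
  "mat_topology n = pullback_topology (carrier_mat n n)
     (\<lambda>M. restrict (\<lambda>p. M $$ p) ({..<n} \<times> {..<n}))
     (product_topology (\<lambda>_. euclidean) ({..<n} \<times> {..<n}))"


section \<open>Matrix state spaces\<close>

text \<open>The amplification \<open>[x\<^sub>i\<^sub>j] \<mapsto> [\<psi>(x\<^sub>i\<^sub>j)]\<close>, with \<open>M\<^sub>k(M\<^sub>n)\<close> regarded as \<open>M\<^sub>k\<^sub>n\<close>.\<close>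

definition amplification ::
    "nat \<Rightarrow> nat \<Rightarrow> ('b \<Rightarrow> complex mat) \<Rightarrow> 'b mat \<Rightarrow> complex mat" where
  "amplification k n \<psi> X = mat (k * n) (k * n)
     (\<lambda>(i, j). \<psi> (X $$ (i div n, j div n)) $$ (i mod n, j mod n))"

definition completely_positive ::
    "'b::unital_cstar_algebra set \<Rightarrow> nat \<Rightarrow> ('b \<Rightarrow> complex mat) \<Rightarrow> bool" where
  "completely_positive S n \<psi> \<longleftrightarrow>
     (\<forall>x\<in>S. \<forall>y\<in>S. \<psi> (x + y) = \<psi> x + \<psi> y) \<and> (\<forall>c. \<forall>x\<in>S. \<psi> (c *\<^sub>C x) = c \<cdot>\<^sub>m \<psi> x) \<and>
     (\<forall>k. \<forall>X\<in>carrier_mat k k. elements_mat X \<subseteq> S \<and> positive_mat k X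
        \<longrightarrow> psd_mat (k * n) (amplification k n \<psi> X))"

definition matrix_states ::
    "'b::unital_cstar_algebra set \<Rightarrow> nat \<Rightarrow> ('b \<Rightarrow> complex mat) set" where
  "matrix_states S n =
     {\<psi> \<in> S \<rightarrow>\<^sub>E carrier_mat n n. completely_positive S n \<psi> \<and> \<psi> 1 = 1\<^sub>m n}"

text \<open>The point-norm topology on the matrix states.\<close>

definition matrix_states_topology ::
    "'b::unital_cstar_algebra set \<Rightarrow> nat \<Rightarrow> ('b \<Rightarrow> complex mat) topology" where
  "matrix_states_topology S n =
     subtopology (product_topology (\<lambda>_. mat_topology n) S) (matrix_states S n)"


section \<open>Free spectrahedra\<close>

text \<open>A \<open>g\<close>-tuple is a function on \<open>{..<g}\<close>, represented extensionally.\<close>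

definition free_spectrahedron ::
    "nat \<Rightarrow> nat \<Rightarrow> (nat \<Rightarrow> complex mat) \<Rightarrow> nat \<Rightarrow> (nat \<Rightarrow> complex mat) set" where
  "free_spectrahedron d g A n =
     {X \<in> {..<g} \<rightarrow>\<^sub>E carrier_mat n n. (\<forall>k<g. hermitian_mat (X k)) \<and>
        psd_mat (d * n)
          (1\<^sub>m (d * n) - mat_sum (d * n) (d * n) (\<lambda>k. kronecker d n (A k) (X k)) {..<g})}"

definition free_spectrahedron_topology ::
    "nat \<Rightarrow> nat \<Rightarrow> (nat \<Rightarrow> complex mat) \<Rightarrow> nat \<Rightarrow> (nat \<Rightarrow> complex mat) topology" where
  "free_spectrahedron_topology d g A n =
     subtopology (product_topology (\<lambda>_. mat_topology n) {..<g}) (free_spectrahedron d g A n)"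

definition conj_tuple :: "nat \<Rightarrow> (nat \<Rightarrow> complex mat) \<Rightarrow> nat \<Rightarrow> complex mat" where
  "conj_tuple g X = (\<lambda>k\<in>{..<g}. map_mat cnj (X k))"


section \<open>Identification of matrix convex sets\<close>

text \<open>
  \<open>matrix_combination n m v F\<close> is the sum of \<open>v\<^sub>i\<^sup>* F\<^sub>i v\<^sub>i\<close> over \<open>i < m\<close>, where the result has
  size \<open>n\<close>, but the sizes of the \<open>F\<^sub>i\<close> may vary with \<open>i\<close>.
\<close>

definition matrix_combination ::
    "nat \<Rightarrow> nat \<Rightarrow> (nat \<Rightarrow> complex mat) \<Rightarrow> (nat \<Rightarrow> complex mat) \<Rightarrow> complex mat" where
  "matrix_combination n m v F = mat_sum n n (\<lambda>i. mat_adjoint (v i) * F i * v i) {..<m}"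

definition matrix_state_space_is_free_spectrahedron ::
    "'b::unital_cstar_algebra set \<Rightarrow> nat \<Rightarrow> nat \<Rightarrow> (nat \<Rightarrow> complex mat) \<Rightarrow> bool" where
  "matrix_state_space_is_free_spectrahedron S d g A \<longleftrightarrow>
     (\<exists>\<theta> :: nat \<Rightarrow> ('b \<Rightarrow> complex mat) \<Rightarrow> (nat \<Rightarrow> complex mat).
        (\<forall>n\<ge>1. homeomorphic_map (matrix_states_topology S n)
                  (free_spectrahedron_topology d g A n) (\<theta> n)) \<and>
        (\<forall>n\<ge>1. \<forall>m. \<forall>N :: nat \<Rightarrow> nat. \<forall>\<psi> v.
           (\<forall>i<m. N i \<ge> 1 \<and> \<psi> i \<in> matrix_states S (N i) \<and> v i \<in> carrier_mat (N i) n) \<and>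
           mat_sum n n (\<lambda>i. mat_adjoint (v i) * v i) {..<m} = 1\<^sub>m n
           \<longrightarrow> \<theta> n (\<lambda>x\<in>S. matrix_combination n m v (\<lambda>i. \<psi> i x)) =
               (\<lambda>k\<in>{..<g}. matrix_combination n m v (\<lambda>i. \<theta> (N i) (\<psi> i) k))))"

end

theory Submission
  imports Defs
begin

text \<open>
  Let \<open>\<omega>\<close> be a pure state on \<open>S\<close>, let \<open>\<phi>\<close> be a state of the C*-algebra that extends it, and let \<open>y\<close> satisfy
  \<open>\<phi> y = 0\<close> and \<open>\<phi> (y\<^sup>* y) = 1\<close>, so that \<open>1\<close> and \<open>y\<close> are orthonormal for the inner product
  \<open>(a, b) \<mapsto> \<phi> (b\<^sup>* a)\<close>. Compressing to their span gives a matrix state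
  \<open>\<psi> x = [\<phi> x, \<phi> (x y); \<phi> (y\<^sup>* x), \<phi> (y\<^sup>* x y)]\<close> of size 2 whose corner is \<open>\<omega>\<close>. The heart of the matter
  is that such a \<open>\<psi>\<close> must be diagonal (\<open>pure_state_dilation_trivial\<close>).

  Let \<open>X\<close> be the point of \<open>\<D>\<^sub>A(2)\<close> that corresponds to \<open>\<psi>\<close>, with corner \<open>c \<in> \<real>\<^sup>g\<close> and off-diagonal part
  \<open>b \<in> \<complex>\<^sup>g\<close>. Positivity of \<open>1 - \<Sum> A\<^sub>k \<otimes> X\<^sub>k\<close> forces \<open>\<Sum> b\<^sub>k A\<^sub>k\<close> to vanish on the kernel of
  \<open>1 - \<Sum> c\<^sub>k A\<^sub>k\<close> (\<open>off_diagonal_kills_kernel\<close>). By the symmetry of \<open>\<D>\<^sub>A(2)\<close> the same holds for the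
  conjugate of \<open>b\<close>, hence for the real vectors \<open>Re b\<close> and \<open>Im b\<close>. But a real direction that kills this
  kernel can be followed a little way, forwards and backwards, without leaving \<open>\<D>\<^sub>A(1)\<close>
  (\<open>pencil_kernel_perturbation\<close>), whereas \<open>c\<close> is an extreme point of \<open>\<D>\<^sub>A(1)\<close> because \<open>\<omega>\<close> is pure
  (\<open>pure_state_extreme\<close>). So \<open>b = 0\<close> and \<open>X\<close> is fixed by conjugation with \<open>diag(1, -1)\<close>; then so is
  \<open>\<psi>\<close>, since the identification of the two matrix convex sets is injective and respects this conjugation.

  Consequently \<open>\<phi> (y\<^sup>* x) = 0\<close> for \<open>x \<in> S\<close> whenever \<open>\<phi> y = 0\<close>, which says that
  \<open>\<phi> (z x) = \<phi> z \<phi> x\<close> for \<open>x \<in> S\<close> and all \<open>z\<close>. The \<open>x\<close> with this property for \<open>x\<close> and \<open>x\<^sup>*\<close> form a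
  C*-subalgebra, so \<open>\<phi>\<close> is multiplicative (\<open>state_multiplicative\<close>). Multiplicative extensions of
  \<open>\<omega>\<close> agree on the C*-algebra generated by \<open>S\<close>, and some extension exists by the Hahn-Banach theorem.

  To pass between contractive functionals and completely positive maps one needs that
  \<open>z\<^sup>* z\<close> is positive in every C*-algebra, in the sense that states are nonnegative on it. This is proved
  first, by a route that avoids spectra and uses only square roots of positive elements.
\<close>

section \<open>Positive elements of a C*-algebra\<close>

lemma star_one [simp]: "star (1::'b::unital_cstar_algebra) = 1"
  by (metis mult.right_neutral mult.left_neutral star_mult star_star)

lemma norm_star [simp]: "norm (star x) = norm (x::'b::unital_cstar_algebra)"
proof -
  have le: "norm z \<le> norm (star z)" for z :: 'b
  proof (cases "z = 0")
    case False
    have "norm z * norm z \<le> norm (star z) * norm z"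
      using norm_mult_ineq[of "star z" z] cstar_identity[of z] by (simp add: power2_eq_square)
    then show ?thesis using False by simp
  qed simp
  show ?thesis using le[of x] le[of "star x"] by (simp add: star_star)
qed

lemma scaleC_one [simp]: "1 *\<^sub>C x = (x::'b::unital_cstar_algebra)"
  using scaleR_scaleC[of 1 x] by simp

lemma scaleC_zero_left [simp]: "0 *\<^sub>C x = (0::'b::unital_cstar_algebra)"
  using scaleR_scaleC[of 0 x] by simp

lemma scaleC_minus_one: "(-1) *\<^sub>C x = - (x::'b::unital_cstar_algebra)"
  using scaleR_scaleC[of "-1" x] by simp

lemma scaleC_minus: "(- c) *\<^sub>C x = - (c *\<^sub>C (x::'b::unital_cstar_algebra))"
  by (metis mult_minus1 scaleC_minus_one scaleC_scaleC)

lemma scaleC_diff_right: "c *\<^sub>C (x - y) = c *\<^sub>C x - c *\<^sub>C (y::'b::unital_cstar_algebra)"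
  using scaleC_add_right[of c x "- y"] scaleC_scaleC[of c "-1" y]
  by (simp add: scaleC_minus_one scaleC_minus)

lemma star_minus [simp]: "star (- x) = - star (x::'b::unital_cstar_algebra)"
  using star_scaleC[of "-1" x] by (simp add: scaleC_minus_one)

lemma star_diff: "star (x - y) = star x - star (y::'b::unital_cstar_algebra)"
  using star_add[of x "- y"] by simp

lemma star_scaleR: "star (r *\<^sub>R x) = r *\<^sub>R star (x::'b::unital_cstar_algebra)"
  by (simp add: scaleR_scaleC star_scaleC)

lemma star_zero [simp]: "star (0::'b::unital_cstar_algebra) = 0"
  using star_diff[of 0 0] by simp

lemma star_sum: "star (\<Sum>i\<in>I. f i) = (\<Sum>i\<in>I. star (f i :: 'b::unital_cstar_algebra))"
  by (induction I rule: infinite_finite_induct) (auto simp: star_add)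

lemma norm_square_hermitian:
  "star x = x \<Longrightarrow> norm (x * x) = (norm (x::'b::unital_cstar_algebra))\<^sup>2"
  using cstar_identity[of x] by simp

lemma tendsto_star: "(f \<longlongrightarrow> l) F \<Longrightarrow> ((\<lambda>n. star (f n :: 'b::unital_cstar_algebra)) \<longlongrightarrow> star l) F"
  by (simp add: tendsto_iff dist_norm star_diff[symmetric])

text \<open>
  The fixed point equation \<open>y = (x + y\<^sup>2) / 2\<close> is equivalent to \<open>(1 - y)\<^sup>2 = 1 - x\<close>. Every iterate is a
  polynomial in \<open>x\<close> with nonnegative coefficients, so for \<open>norm x \<le> 1\<close> it is dominated by the
  scalar iteration with \<open>x = 1\<close>, which increases to \<open>1\<close>. Convergence thus holds up to and including
  \<open>norm x = 1\<close>.
\<close>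

primrec sqrt_iter :: "'a::real_normed_algebra_1 \<Rightarrow> nat \<Rightarrow> 'a" where
  "sqrt_iter x 0 = 0"
| "sqrt_iter x (Suc n) = (1/2) *\<^sub>R (x + sqrt_iter x n * sqrt_iter x n)"

lemma sqrt_iter_commute: "z * x = x * z \<Longrightarrow> z * sqrt_iter x n = sqrt_iter x n * z"
proof (induction n)
  case (Suc n)
  then have "z * (sqrt_iter x n * sqrt_iter x n) = (sqrt_iter x n * sqrt_iter x n) * z"
    by (metis mult.assoc)
  with Suc show ?case by (simp add: distrib_left distrib_right)
qed simp

lemma sqrt_iter_real: "0 \<le> sqrt_iter (1::real) n \<and> sqrt_iter (1::real) n \<le> 1
    \<and> sqrt_iter (1::real) n \<le> sqrt_iter 1 (Suc n)"
proof (induction n)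
  case (Suc n)
  let ?r = "sqrt_iter (1::real)"
  have r: "0 \<le> ?r n" "?r n \<le> 1" "?r n \<le> ?r (Suc n)" using Suc by auto
  have "?r (Suc n) * ?r (Suc n) \<ge> ?r n * ?r n" using r by (intro mult_mono) auto
  moreover have "?r n * ?r n \<le> 1" "0 \<le> ?r n * ?r n" using r mult_mono[of "?r n" 1 "?r n" 1] by auto
  ultimately show ?case by simp
qed simp

text \<open>
  The increments telescope against those of the scalar iteration: the factorization
  \<open>y'\<^sup>2 - y\<^sup>2 = (y' + y) (y' - y)\<close>, valid as iterates commute, passes the domination from one increment
  to the next.
\<close>

lemma sqrt_iter_converges:
  assumes "norm (x::'a::{real_normed_algebra_1,banach}) \<le> 1"
  obtains l where "sqrt_iter x \<longlonglongrightarrow> l" "norm l \<le> 1"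
proof -
  let ?r = "sqrt_iter (1::real)" and ?y = "sqrt_iter x"
  have n: "norm (?y n) \<le> ?r n" for n
  proof (induction n)
    case (Suc n)
    have "norm (?y n * ?y n) \<le> ?r n * ?r n"
      using Suc norm_mult_ineq[of "?y n" "?y n"] mult_mono'[OF Suc Suc] by auto
    then show ?case using assms norm_triangle_ineq[of x "?y n * ?y n"] by simp
  qed simp
  have d: "norm (?y (Suc n) - ?y n) \<le> ?r (Suc n) - ?r n" for n
  proof (induction n)
    case 0 then show ?case using assms by simp
  next
    case (Suc n)
    have c: "?y n * ?y (Suc n) = ?y (Suc n) * ?y n"
      by (intro sqrt_iter_commute) (metis sqrt_iter_commute)
    have "?y (Suc (Suc n)) - ?y (Suc n)
        = (1/2) *\<^sub>R (?y (Suc n) * ?y (Suc n) - ?y n * ?y n)"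
      by (subst (1 2) sqrt_iter.simps(2)) (simp add: scaleR_diff_right[symmetric] del: sqrt_iter.simps)
    also have "\<dots> = (1/2) *\<^sub>R ((?y (Suc n) + ?y n) * (?y (Suc n) - ?y n))"
      using c by (simp add: algebra_simps del: sqrt_iter.simps)
    finally have "norm (?y (Suc (Suc n)) - ?y (Suc n))
        = norm ((?y (Suc n) + ?y n) * (?y (Suc n) - ?y n)) / 2" by simp
    also have "\<dots> \<le> (norm (?y (Suc n) + ?y n) * norm (?y (Suc n) - ?y n)) / 2"
      by (simp add: norm_mult_ineq del: sqrt_iter.simps)
    also have "\<dots> \<le> ((?r (Suc n) + ?r n) * (?r (Suc n) - ?r n)) / 2"
      using Suc n[of n] n[of "Suc n"] norm_triangle_ineq[of "?y (Suc n)" "?y n"]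
        sqrt_iter_real[of n] sqrt_iter_real[of "Suc n"]
      by (intro divide_right_mono mult_mono) (auto simp del: sqrt_iter.simps)
    also have "\<dots> = ?r (Suc (Suc n)) - ?r (Suc n)"
      by (subst (2 3) sqrt_iter.simps(2)) (simp add: algebra_simps del: sqrt_iter.simps, simp add: field_simps)
    finally show ?case .
  qed
  have "incseq ?r" using sqrt_iter_real by (auto intro: incseq_SucI)
  moreover have "bdd_above (range ?r)" using sqrt_iter_real by (auto intro!: bdd_aboveI[of _ 1])
  ultimately obtain L where "?r \<longlonglongrightarrow> L" using LIMSEQ_incseq_SUP by blast
  then have "summable (\<lambda>n. ?r (Suc n) - ?r n)" by (rule telescope_summable)
  then have "summable (\<lambda>n. ?y (Suc n) - ?y n)"
    by (rule summable_comparison_test'[of _ 0]) (rule d)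
  then have "(\<lambda>n. \<Sum>k<n. ?y (Suc k) - ?y k) \<longlonglongrightarrow> (\<Sum>k. ?y (Suc k) - ?y k)"
    by (rule summable_LIMSEQ)
  then have y: "?y \<longlonglongrightarrow> (\<Sum>k. ?y (Suc k) - ?y k)"
    by (simp only: sum_lessThan_telescope sqrt_iter.simps(1) diff_0_right)
  have "norm (?y k) \<le> 1" for k using n[of k] sqrt_iter_real[of k] by simp
  then have "norm (\<Sum>k. ?y (Suc k) - ?y k) \<le> 1"
    using y by (intro LIMSEQ_le_const2[OF tendsto_norm[OF y]]) auto
  then show ?thesis using that y by blast
qed

lemma hermitian_sqrt_exists:
  assumes "star x = x" "norm (x::'b::unital_cstar_algebra) \<le> 1"
  obtains c where "star c = c" "c * c = 1 - x" "norm (1 - c) \<le> 1" "\<And>z. z * x = x * z \<Longrightarrow> z * c = c * z"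
proof -
  obtain l where l: "sqrt_iter x \<longlonglongrightarrow> l" and nl: "norm l \<le> 1" using sqrt_iter_converges assms(2) by blast
  have "(\<lambda>n. sqrt_iter x (Suc n)) \<longlonglongrightarrow> (1/2) *\<^sub>R (x + l * l)"
    unfolding sqrt_iter.simps by (intro tendsto_intros l)
  then have eq: "l = (1/2) *\<^sub>R (x + l * l)" using l LIMSEQ_Suc LIMSEQ_unique by blast
  have "x + l * l = 2 *\<^sub>R l" by (subst (3) eq) simp
  then have sq: "(1 - l) * (1 - l) = 1 - x"
    by (simp add: algebra_simps scaleR_2)
  have "star (sqrt_iter x n) = sqrt_iter x n" for n
    by (induction n) (auto simp: assms star_add star_mult star_scaleR)
  then have "(\<lambda>n. star (sqrt_iter x n)) = sqrt_iter x" by auto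
  then have "star l = l" using tendsto_star[OF l] l LIMSEQ_unique by metis
  then have "star (1 - l) = 1 - l" by (simp add: star_diff)
  moreover have "z * l = l * z" if "z * x = x * z" for z
  proof -
    have "(\<lambda>n. z * sqrt_iter x n) \<longlonglongrightarrow> z * l" "(\<lambda>n. sqrt_iter x n * z) \<longlonglongrightarrow> l * z"
      by (intro tendsto_intros l)+
    then show ?thesis using sqrt_iter_commute[OF that] LIMSEQ_unique by auto
  qed
  then have "z * (1 - l) = (1 - l) * z" if "z * x = x * z" for z
    using that by (simp add: algebra_simps)
  moreover have "norm (1 - (1 - l)) \<le> 1" using nl by simp
  ultimately show ?thesis using sq that by blast
qed

text \<open>
  With the continuous functional calculus this says that the spectrum lies in \<open>[0, 2t]\<close>. The norm
  formulation makes the positive elements visibly a convex cone on which states are nonnegative.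
\<close>

definition pos_elt :: "'b::unital_cstar_algebra \<Rightarrow> bool" where
  "pos_elt a \<longleftrightarrow> star a = a \<and> (\<exists>t\<ge>0. norm (t *\<^sub>R 1 - a) \<le> t)"

lemma pos_eltI: "star a = a \<Longrightarrow> 0 \<le> t \<Longrightarrow> norm (t *\<^sub>R 1 - a) \<le> t \<Longrightarrow> pos_elt a"
  by (auto simp: pos_elt_def)

lemma pos_elt_add:
  assumes "pos_elt a" "pos_elt b" shows "pos_elt (a + b)"
proof -
  obtain s t where st: "0 \<le> s" "norm (s *\<^sub>R 1 - a) \<le> s" "0 \<le> t" "norm (t *\<^sub>R 1 - b) \<le> t"
    using assms by (auto simp: pos_elt_def)
  have "norm ((s + t) *\<^sub>R 1 - (a + b)) \<le> s + t"
    using norm_triangle_ineq[of "s *\<^sub>R 1 - a" "t *\<^sub>R 1 - b"] st by (simp add: algebra_simps)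
  moreover have "star (a + b) = a + b" using assms by (simp add: pos_elt_def star_add)
  ultimately show ?thesis using st by (intro pos_eltI[of _ "s + t"]) auto
qed

lemma pos_elt_scaleR:
  assumes "pos_elt a" "0 \<le> r" shows "pos_elt (r *\<^sub>R a)"
proof -
  obtain t where t: "0 \<le> t" "norm (t *\<^sub>R 1 - a) \<le> t" using assms by (auto simp: pos_elt_def)
  have "(r * t) *\<^sub>R 1 - r *\<^sub>R a = r *\<^sub>R (t *\<^sub>R 1 - a)" by (simp add: algebra_simps)
  then have "norm ((r * t) *\<^sub>R 1 - r *\<^sub>R a) \<le> r * t" using t assms by (simp add: mult_left_mono)
  moreover have "star (r *\<^sub>R a) = r *\<^sub>R a" using assms by (simp add: pos_elt_def star_scaleR)
  ultimately show ?thesis using t assms by (intro pos_eltI[of _ "r * t"]) auto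
qed

lemma pos_elt_sqrt:
  assumes "pos_elt a"
  obtains b where "star b = b" "b * b = a" "pos_elt b" "\<And>z. z * a = a * z \<Longrightarrow> z * b = b * z"
proof -
  obtain t where t: "0 \<le> t" "norm (t *\<^sub>R 1 - a) \<le> t" and sa: "star a = a"
    using assms by (auto simp: pos_elt_def)
  show ?thesis
  proof (cases "t = 0")
    case True then show ?thesis using t by (intro that[of 0]) (auto simp: pos_elt_def)
  next
    case False
    let ?x = "1 - (1/t) *\<^sub>R a"
    have "?x = (1/t) *\<^sub>R (t *\<^sub>R 1 - a)" using False by (simp add: algebra_simps)
    then have "norm ?x = norm (t *\<^sub>R 1 - a) / t" using t by simp
    then have "norm ?x \<le> 1" using t False by simp
    moreover have "star ?x = ?x" by (simp add: star_diff star_scaleR sa)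
    ultimately obtain c where c: "star c = c" "c * c = 1 - ?x" "norm (1 - c) \<le> 1" "\<And>z. z * ?x = ?x * z \<Longrightarrow> z * c = c * z"
      using hermitian_sqrt_exists by blast
    have "z * (sqrt t *\<^sub>R c) = (sqrt t *\<^sub>R c) * z" if "z * a = a * z" for z
      using c(4)[of z] that by (simp add: algebra_simps)
    moreover have "pos_elt (sqrt t *\<^sub>R c)"
      using c(1,3) t by (intro pos_elt_scaleR) (auto simp: pos_elt_def intro!: exI[of _ 1])
    moreover have "star (sqrt t *\<^sub>R c) = sqrt t *\<^sub>R c" by (simp only: star_scaleR c(1))
    moreover have "(sqrt t *\<^sub>R c) * (sqrt t *\<^sub>R c) = t *\<^sub>R (c * c)" using t by simp
    then have "(sqrt t *\<^sub>R c) * (sqrt t *\<^sub>R c) = a" unfolding c(2) using False by simp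
    ultimately show ?thesis using that by blast
  qed
qed

text \<open>
  The normal element \<open>u = a + i b\<close> has \<open>u\<^sup>* u = a\<^sup>2 + b\<^sup>2\<close>, and \<open>a\<close> is its real part. This replaces the
  order-theoretic estimate \<open>a\<^sup>2 \<le> a\<^sup>2 + b\<^sup>2\<close>.
\<close>

lemma norm_Re_part_le:
  assumes "star a = a" "star b = b" "a * b = b * a"
  shows "norm (a::'b::unital_cstar_algebra) ^ 2 \<le> norm (a * a + b * b)"
proof -
  let ?u = "a + \<i> *\<^sub>C b"
  have su: "star ?u = a - \<i> *\<^sub>C b"
    using assms by (simp add: star_add star_scaleC scaleC_minus)
  have "star ?u * ?u = a * a + b * b"
    unfolding su using assms
    by (simp add: algebra_simps mult_scaleC_left mult_scaleC_right scaleC_scaleC scaleC_minus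
      scaleC_diff_right scaleC_minus_one)
  then have nu: "norm ?u ^ 2 = norm (a * a + b * b)" using cstar_identity[of ?u] by simp
  have "?u + star ?u = 2 *\<^sub>R a"
    unfolding su by (simp add: scaleR_2)
  then have "2 * norm a \<le> norm ?u + norm (star ?u)"
    using norm_triangle_ineq[of ?u "star ?u"] by simp
  then have "norm a \<le> norm ?u" by simp
  then show ?thesis using nu power_mono[of "norm a" "norm ?u" 2] by simp
qed

text \<open>
  If \<open>norm b \<le> 1\<close>, there is a hermitian \<open>c\<close> that commutes with \<open>b\<close> and satisfies \<open>b\<^sup>2 + c\<^sup>2 = 1\<close>. Then
  \<open>norm (1 - b\<^sup>2) = (norm c)\<^sup>2 \<le> 1\<close> because \<open>c\<close> is the real part of a unitary.
\<close>

lemma pos_elt_square: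
  fixes b :: "'b::unital_cstar_algebra"
  assumes "star b = b"
  shows "pos_elt (b * b)"
proof -
  have "pos_elt (b * b)" if b: "star b = b" "norm b \<le> 1" for b :: 'b
  proof -
    have "norm (b * b) \<le> 1" using b norm_mult_ineq[of b b] mult_le_one[of "norm b" "norm b"] by simp
    moreover have sbb: "star (b * b) = b * b" using b by (simp add: star_mult)
    ultimately obtain c where c: "star c = c" "c * c = 1 - b * b" "b * c = c * b"
      using hermitian_sqrt_exists[of "b * b"] by (metis mult.assoc)
    have "norm c ^ 2 \<le> norm (c * c + b * b)" using c b by (intro norm_Re_part_le) auto
    then have "norm (c * c) \<le> 1" unfolding norm_square_hermitian[OF c(1)] using c by simp
    then show ?thesis using sbb c by (auto simp: pos_elt_def intro!: exI[of _ 1])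
  qed note small = this
  show ?thesis
  proof (cases "b = 0")
    case False
    let ?b = "(1 / norm b) *\<^sub>R b"
    have "pos_elt (?b * ?b)" using False assms by (intro small) (auto simp: star_scaleR)
    then have "pos_elt ((norm b)\<^sup>2 *\<^sub>R (?b * ?b))" by (rule pos_elt_scaleR) simp
    then show ?thesis using False by (simp add: power2_eq_square)
  qed (auto simp: pos_elt_def intro: exI[of _ 0])
qed

text \<open>
  For \<open>a = b\<^sup>2\<close> and \<open>-a = c\<^sup>2\<close> with commuting roots, \<open>b\<close> is the real part of an element whose square norm
  is that of \<open>b\<^sup>2 + c\<^sup>2 = 0\<close>.
\<close>

lemma pos_elt_antisym:
  assumes "pos_elt a" "pos_elt (- a)" shows "a = 0"
proof -
  obtain b where b: "star b = b" "b * b = a" "\<And>z. z * a = a * z \<Longrightarrow> z * b = b * z"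
    using pos_elt_sqrt[OF assms(1)] by blast
  obtain c where c: "star c = c" "c * c = - a" "\<And>z. z * (- a) = (- a) * z \<Longrightarrow> z * c = c * z"
    using pos_elt_sqrt[OF assms(2)] by blast
  have "b * a = a * b" using b(2) by (metis mult.assoc)
  then have "b * (- a) = (- a) * b" by (simp only: mult_minus_left mult_minus_right)
  then have "b * c = c * b" by (rule c(3))
  then have "norm b ^ 2 \<le> norm (b * b + c * c)" by (rule norm_Re_part_le[OF b(1) c(1)])
  then have "b = 0" by (simp add: b(2) c(2))
  then show ?thesis using b(2) by simp
qed

lemma pos_elt_add_eq_0:
  assumes "pos_elt a" "pos_elt b" "a + b = 0" shows "a = 0"
  using assms pos_elt_antisym[of a] by (metis add.inverse_unique)

lemma hermitian_decomposition:
  obtains a b where "star a = a" "star b = b" "z = a + \<i> *\<^sub>C (b::'b::unital_cstar_algebra)"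
proof -
  let ?a = "(1/2) *\<^sub>R (z + star z)" and ?b = "(- \<i> / 2) *\<^sub>C (z - star z)"
  have "\<i> *\<^sub>C ?b = (1/2) *\<^sub>R (z - star z)" by (simp add: scaleC_scaleC scaleR_scaleC)
  then have "?a + \<i> *\<^sub>C ?b = (1/2) *\<^sub>R (z + z)" by (simp add: scaleR_add_right[symmetric])
  then have "z = ?a + \<i> *\<^sub>C ?b" by (simp add: scaleR_2[symmetric])
  moreover have "star ?a = ?a" by (simp add: star_scaleR star_add star_star add.commute)
  moreover have "star ?b = (\<i> / 2) *\<^sub>C (- (z - star z))" by (simp add: star_scaleC star_diff star_star)
  then have "star ?b = ?b" by (simp only: scaleC_minus_one[symmetric] scaleC_scaleC) simp
  ultimately show ?thesis using that by blast
qed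

lemma star_mult_self_commuted_sum:
  obtains a b where "star a = a" "star b = b"
    "star v * v + v * star v = 2 *\<^sub>R (a * a) + 2 *\<^sub>R (b * (b::'b::unital_cstar_algebra))"
proof -
  obtain a b where ab: "star a = a" "star b = b" "v = a + \<i> *\<^sub>C b" by (rule hermitian_decomposition)
  have sv: "star v = a - \<i> *\<^sub>C b"
    unfolding ab(3) using ab(1,2) by (simp add: star_add star_scaleC scaleC_minus)
  have ii: "(\<i> *\<^sub>C b) * (\<i> *\<^sub>C b) = - (b * b)"
    by (simp add: mult_scaleC_left mult_scaleC_right scaleC_scaleC scaleC_minus_one)
  have "star v * v + v * star v = 2 *\<^sub>R (a * a) - 2 *\<^sub>R ((\<i> *\<^sub>C b) * (\<i> *\<^sub>C b))"
    by (subst sv, subst sv, subst (1 2) ab(3)) (simp add: algebra_simps scaleR_2)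
  then show ?thesis using ab that unfolding ii by simp
qed

text \<open>
  Put \<open>h = z\<^sup>* z\<close> and \<open>a = sqrt (h\<^sup>2)\<close>, to be thought of as the absolute value of \<open>h\<close>, and let
  \<open>m = (a - h) / 2\<close> be the negative part of \<open>h\<close>; the claim is \<open>m = 0\<close>. The element \<open>w = z m\<close> satisfies
  \<open>w\<^sup>* w = - m\<^sup>3\<close>, and \<open>k = m\<^sup>3\<close> is the square of a hermitian \<open>q\<close>. Usually one now compares the
  spectra of \<open>w\<^sup>* w\<close> and \<open>w w\<^sup>*\<close>. Passing to \<open>v = w q\<close> avoids this, as both \<open>v\<^sup>* v = - k\<^sup>2\<close> and
  \<open>v v\<^sup>* = - (w w\<^sup>*)\<^sup>2\<close> are negatives of squares, while \<open>v\<^sup>* v + v v\<^sup>*\<close> is a sum of squares: hence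
  \<open>k\<^sup>2 = 0\<close>.
\<close>

lemma pos_elt_star_mult_self: "pos_elt (star z * (z::'b::unital_cstar_algebra))"
proof -
  define h where "h = star z * z"
  have sh: "star h = h" by (simp add: h_def star_mult star_star)
  obtain a where a: "star a = a" "a * a = h * h" "pos_elt a" "\<And>x. x * h = h * x \<Longrightarrow> x * a = a * x"
    proof (rule pos_elt_sqrt[OF pos_elt_square[OF sh]])
    fix a assume a: "star a = a" "a * a = h * h" "pos_elt a" "\<And>x. x * (h * h) = h * h * x \<Longrightarrow> x * a = a * x"
    have "x * a = a * x" if "x * h = h * x" for x
      using that a(4)[of x] by (metis mult.assoc)
    with a that show ?thesis by blast
  qed
  obtain e where e: "star e = e" "e * e = a" "\<And>x. x * a = a * x \<Longrightarrow> x * e = e * x"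
    using pos_elt_sqrt[OF a(3)] by blast
  define m where "m = (1/2) *\<^sub>R (a - h)"
  have sm: "star m = m" by (simp add: m_def star_scaleR star_diff a sh)
  have ha: "h * a = a * h" by (rule a(4)) simp
  have am: "a * m = m * a" using ha by (simp add: m_def right_diff_distrib left_diff_distrib)
  have em: "e * m = m * e" using e(3)[of m] am by simp
  have "(a + h) * (a - h) = 0" using ha a(2) by (simp add: right_diff_distrib distrib_right)
  then have ahm: "(a + h) * m = 0" by (simp add: m_def)
  have half: "x = (1/2) *\<^sub>R x + (1/2) *\<^sub>R x" for x :: 'b by (simp flip: scaleR_add_left)
  have "m - a = - ((1/2) *\<^sub>R (a + h))"
    by (subst (2) half) (simp add: m_def scaleR_add_right scaleR_diff_right)
  then have "(m - a) * m = 0" using ahm by simp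
  then have mm: "m * m = a * m" by (simp add: left_diff_distrib)
  have "h + m = (1/2) *\<^sub>R (a + h)"
    by (subst (1) half) (simp add: m_def scaleR_add_right scaleR_diff_right)
  then have "(h + m) * m = 0" using ahm by simp
  then have hmm: "h * m = - (m * m)" by (simp add: distrib_right add_eq_0_iff2)
  define k where "k = m * m * m"
  have sk: "star k = k" by (simp add: k_def star_mult sm mult.assoc)
  define q where "q = e * m"
  have sq: "star q = q" by (simp add: q_def star_mult sm e em)
  have qq: "q * q = k"
  proof -
    have "q * q = e * (m * e) * m" by (simp add: q_def mult.assoc)
    also have "\<dots> = (e * e) * m * m" by (simp add: em mult.assoc)
    also have "\<dots> = k" by (simp add: k_def e(2) mm)
    finally show ?thesis .
  qed
  define w where "w = z * m"
  have ww: "star w * w = - k"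
  proof -
    have "star w * w = m * (h * m)" by (simp add: w_def h_def star_mult sm mult.assoc)
    then show ?thesis by (simp add: hmm k_def mult.assoc)
  qed
  define v where "v = w * q"
  define p where "p = w * star w"
  have sp: "star p = p" by (simp add: p_def star_mult star_star)
  have "star v * v = q * (star w * w) * q" by (simp add: v_def star_mult sq mult.assoc)
  also have "\<dots> = - (k * k)" unfolding ww by (simp add: qq[symmetric] mult.assoc)
  finally have 1: "star v * v = - (k * k)" .
  have "v * star v = w * (q * q) * star w" by (simp add: v_def star_mult sq mult.assoc)
  also have "\<dots> = w * (- (star w * w)) * star w" unfolding ww qq by simp
  also have "\<dots> = - (p * p)" by (simp add: p_def mult.assoc)
  finally have 2: "v * star v = - (p * p)" .
  obtain b c where bc: "star b = b" "star c = c" "star v * v + v * star v = 2 *\<^sub>R (b * b) + 2 *\<^sub>R (c * c)"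
    by (rule star_mult_self_commuted_sum)
  have "k * k + (p * p + (2 *\<^sub>R (b * b) + 2 *\<^sub>R (c * c))) = 0"
    unfolding bc(3)[symmetric] 1 2 by simp
  moreover have "pos_elt (p * p + (2 *\<^sub>R (b * b) + 2 *\<^sub>R (c * c)))"
    by (intro pos_elt_add pos_elt_scaleR pos_elt_square sp bc) auto
  ultimately have "k * k = 0" using pos_elt_add_eq_0 pos_elt_square[OF sk] by blast
  then have "norm k = 0" using norm_square_hermitian[OF sk] by simp
  then have "(m * m) * (m * m) = 0" by (simp add: k_def mult.assoc[symmetric])
  moreover have "star (m * m) = m * m" by (simp add: star_mult sm)
  ultimately have "norm (m * m) = 0" using norm_square_hermitian[of "m * m"] by simp
  then have "norm m = 0" using norm_square_hermitian[OF sm] by simp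
  then have "a = h" by (simp add: m_def)
  then show ?thesis using a(3) by (simp add: h_def)
qed

section \<open>The Hahn-Banach extension theorem\<close>

text \<open>
  For positive multiples the inequality implies equality, and unlike equality it passes directly to
  infima of functionals.
\<close>

definition sublinear :: "('a::real_vector \<Rightarrow> real) \<Rightarrow> bool" where
  "sublinear p \<longleftrightarrow> (\<forall>x y. p (x + y) \<le> p x + p y) \<and> (\<forall>r>0. \<forall>x. p (r *\<^sub>R x) \<le> r * p x)"

lemma sublinear_add: "sublinear p \<Longrightarrow> p (x + y) \<le> p x + p y"
  by (simp add: sublinear_def)

lemma sublinear_scaleR:
  assumes "sublinear p" "0 < r" shows "p (r *\<^sub>R x) = r * p x"
proof -
  have "p ((1/r) *\<^sub>R r *\<^sub>R x) \<le> (1/r) * p (r *\<^sub>R x)"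
    using assms unfolding sublinear_def by (meson zero_less_divide_1_iff)
  then have "r * p x \<le> p (r *\<^sub>R x)" using assms(2) by (simp add: field_simps)
  moreover have "p (r *\<^sub>R x) \<le> r * p x" using assms by (simp add: sublinear_def)
  ultimately show ?thesis by simp
qed

lemma sublinear_zero [simp]: "sublinear p \<Longrightarrow> p 0 = 0"
  using sublinear_scaleR[of p 2 0] by simp

lemma sublinear_minus: "sublinear p \<Longrightarrow> - p (- x) \<le> p x"
  using sublinear_add[of p x "- x"] by simp

text \<open>
  The common core of the three infima below: over a chain of functionals, over the translates in one
  direction, and over a subspace.
\<close>

lemma sublinear_INF:
  fixes f :: "'i \<Rightarrow> 'a::real_vector \<Rightarrow> real"
  assumes "I \<noteq> {}" and bdd: "\<And>i x. i \<in> I \<Longrightarrow> b x \<le> f i x"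
    and add: "\<And>i j x y. i \<in> I \<Longrightarrow> j \<in> I \<Longrightarrow> \<exists>k\<in>I. f k (x + y) \<le> f i x + f j y"
    and scale: "\<And>i r x. i \<in> I \<Longrightarrow> 0 < r \<Longrightarrow> \<exists>k\<in>I. f k (r *\<^sub>R x) \<le> r * f i x"
  shows "sublinear (\<lambda>x. INF i\<in>I. f i x)" and "i \<in> I \<Longrightarrow> (INF i\<in>I. f i x) \<le> f i x"
proof -
  let ?u = "\<lambda>x. INF i\<in>I. f i x"
  have low: "?u x \<le> f i x" if "i \<in> I" for i x
    using bdd by (intro cINF_lower that bdd_belowI[of _ "b x"]) auto
  then show "i \<in> I \<Longrightarrow> ?u x \<le> f i x" .
  have "?u (x + y) \<le> ?u x + ?u y" for x y
  proof -
    have ij: "?u (x + y) - f i x \<le> f j y" if "i \<in> I" "j \<in> I" for i j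
      using add[OF that, of x y] low[of _ "x + y"] by fastforce
    have "?u (x + y) - f i x \<le> ?u y" if "i \<in> I" for i
      by (intro cINF_greatest \<open>I \<noteq> {}\<close> ij that)
    then have i: "?u (x + y) - ?u y \<le> f i x" if "i \<in> I" for i using that by fastforce
    have "?u (x + y) - ?u y \<le> ?u x" by (intro cINF_greatest \<open>I \<noteq> {}\<close> i)
    then show ?thesis by simp
  qed
  moreover have "?u (r *\<^sub>R x) \<le> r * ?u x" if "0 < r" for r x
  proof -
    have "?u (r *\<^sub>R x) \<le> r * f i x" if "i \<in> I" for i
      using scale[OF that \<open>0 < r\<close>, of x] low order_trans by blast
    then have "?u (r *\<^sub>R x) / r \<le> ?u x"
      using that by (intro cINF_greatest assms) (auto simp: field_simps)
    then show ?thesis using that by (simp add: field_simps)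
  qed
  ultimately show "sublinear ?u" by (auto simp: sublinear_def)
qed

lemma minimal_sublinear_exists:
  assumes "sublinear p"
  obtains q where "sublinear q" "\<And>x. q x \<le> p x"
    "\<And>r. sublinear r \<Longrightarrow> (\<And>x. r x \<le> q x) \<Longrightarrow> r = q"
proof -
  let ?A = "{q. sublinear q \<and> (\<forall>x. q x \<le> p x)}" and ?P = "\<lambda>q r::'a \<Rightarrow> real. \<forall>x. r x \<le> q x"
  have "\<exists>q\<in>?A. \<forall>r\<in>?A. ?P q r \<longrightarrow> r = q"
  proof (rule predicate_Zorn)
    show "partial_order_on ?A (relation_of ?P ?A)"
      by (intro partial_order_on_relation_ofI) (auto intro: order_trans intro!: ext antisym)
    fix C assume C: "C \<in> Chains (relation_of ?P ?A)"
    then have CA: "C \<subseteq> ?A" and tot: "\<And>q r. q \<in> C \<Longrightarrow> r \<in> C \<Longrightarrow> ?P q r \<or> ?P r q"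
      by (auto simp: Chains_def relation_of_def)
    show "\<exists>u\<in>?A. \<forall>q\<in>C. ?P q u"
    proof (cases "C = {}")
      case True then show ?thesis using assms by auto
    next
      case False
      have b: "- p (- x) \<le> q x" if "q \<in> C" for q x
      proof -
        have "sublinear q" "q (- x) \<le> p (- x)" using that CA by auto
        then show ?thesis using sublinear_minus[of q x] by linarith
      qed
      have a: "\<exists>k\<in>C. k (x + y) \<le> q x + r y" if "q \<in> C" "r \<in> C" for q r x y
      proof -
        have s: "q (x + y) \<le> q x + q y" "r (x + y) \<le> r x + r y"
          using that CA sublinear_add by blast+
        show ?thesis
        proof (cases "?P q r")
          case True
          then have "r x \<le> q x" by simp
          then show ?thesis using that s by (intro bexI[of _ r]) auto
        next
          case False
          then have "q y \<le> r y" using tot[OF that] by auto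
          then show ?thesis using that s by (intro bexI[of _ q]) auto
        qed
      qed
      have c: "\<exists>k\<in>C. k (r *\<^sub>R x) \<le> r * q x" if "q \<in> C" "0 < r" for q r x
        using that CA by (intro bexI[of _ q]) (auto simp: sublinear_def)
      have u: "sublinear (\<lambda>x. INF q\<in>C. q x)" "\<And>q x. q \<in> C \<Longrightarrow> (INF q\<in>C. q x) \<le> q x"
        by (rule sublinear_INF[of C "\<lambda>x. - p (- x)" "\<lambda>q. q"]; use False b a c in blast)+
      obtain q0 where "q0 \<in> C" using False by auto
      then have "(INF q\<in>C. q x) \<le> p x" for x using u(2)[of q0 x] CA by (force intro: order_trans)
      then show ?thesis using u by (intro bexI[of _ "\<lambda>x. INF q\<in>C. q x"]) auto
    qed
  qed
  then obtain q where q: "q \<in> ?A" "\<And>r. r \<in> ?A \<Longrightarrow> ?P q r \<Longrightarrow> r = q" by blast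
  show ?thesis
  proof (rule that)
    fix r assume "sublinear r" "\<And>x. r x \<le> q x"
    then show "r = q" using q by (intro q(2)) (auto intro: order_trans)
  qed (use q in auto)
qed

text \<open>
  Replacing \<open>q x\<close> by the infimum of \<open>q (x + t y) - t q y\<close> over \<open>t \<ge> 0\<close> gives a smaller sublinear
  functional, hence the same one; \<open>t = 1\<close> yields superadditivity.
\<close>

lemma minimal_sublinear_additive:
  assumes q: "sublinear q" and min: "\<And>r. sublinear r \<Longrightarrow> (\<And>x. r x \<le> q x) \<Longrightarrow> r = q"
  shows "q (x + y) = q x + q y"
proof -
  let ?f = "\<lambda>t x. q (x + t *\<^sub>R y) - t * q y"
  have sc: "q (t *\<^sub>R y) = t * q y" if "t \<in> {0..}" for t
    using that q sublinear_scaleR[of q t y] by (cases "t = 0") auto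
  have b: "- q (- x) \<le> ?f t x" if "t \<in> {0..}" for t x
    using sublinear_add[OF q, of "x + t *\<^sub>R y" "- x"] sc[OF that] by simp
  have a: "\<exists>k\<in>{0..}. ?f k (x + x') \<le> ?f s x + ?f t x'" if "s \<in> {0..}" "t \<in> {0..}" for s t x x'
    using that sublinear_add[OF q, of "x + s *\<^sub>R y" "x' + t *\<^sub>R y"]
    by (intro bexI[of _ "s + t"]) (auto simp: algebra_simps)
  have c: "\<exists>k\<in>{0..}. ?f k (r *\<^sub>R x) \<le> r * ?f t x" if "t \<in> {0..}" "0 < r" for t r x
    using that sublinear_scaleR[OF q \<open>0 < r\<close>, of "x + t *\<^sub>R y"]
    by (intro bexI[of _ "r * t"]) (auto simp: algebra_simps)
  have u: "sublinear (\<lambda>x. INF t\<in>{0..}. ?f t x)" "\<And>t x. t \<in> {0..} \<Longrightarrow> (INF t\<in>{0..}. ?f t x) \<le> ?f t x"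
    using sublinear_INF[of "{0..}" "\<lambda>x. - q (- x)" ?f, OF _ b a c] by auto
  have "(\<lambda>x. INF t\<in>{0..}. ?f t x) = q" using u(2)[of 0] by (intro min u(1)) auto
  then have "(INF t\<in>{0..}. ?f t x) = q x" by (rule fun_cong)
  then have "q x \<le> ?f 1 x" using u(2)[of 1 x] by simp
  then show ?thesis using sublinear_add[OF q, of x y] by simp
qed

text \<open>
  The infimum of \<open>p (x - s) + f s\<close> over \<open>s \<in> M\<close> is sublinear, below \<open>p\<close> everywhere and below \<open>f\<close> on \<open>M\<close>. A
  minimal sublinear functional below it is linear, and a linear functional below \<open>f\<close> on the subspace
  \<open>M\<close> equals \<open>f\<close> there.
\<close>

lemma Hahn_Banach:
  fixes p :: "'a::real_vector \<Rightarrow> real"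
  assumes p: "sublinear p" and M0: "0 \<in> M"
    and M_add: "\<And>x y. x \<in> M \<Longrightarrow> y \<in> M \<Longrightarrow> x + y \<in> M"
    and M_scale: "\<And>r x. x \<in> M \<Longrightarrow> r *\<^sub>R x \<in> M"
    and f_add: "\<And>x y. x \<in> M \<Longrightarrow> y \<in> M \<Longrightarrow> f (x + y) = f x + f y"
    and f_scale: "\<And>r x. x \<in> M \<Longrightarrow> f (r *\<^sub>R x) = r * f x"
    and f_le: "\<And>x. x \<in> M \<Longrightarrow> f x \<le> p x"
  obtains F where "linear F" "\<And>x. F x \<le> p x" "\<And>x. x \<in> M \<Longrightarrow> F x = f x"
proof -
  let ?f = "\<lambda>s x. p (x - s) + f s"
  have fm: "- s \<in> M \<and> f (- s) = - f s" if "s \<in> M" for s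
    using M_scale[OF that, of "-1"] f_scale[OF that, of "-1"] by simp
  have b: "- p (- x) \<le> ?f s x" if "s \<in> M" for s x
    using sublinear_add[OF p, of "x - s" "- x"] f_le[of "- s"] fm[OF that] by simp
  have a: "\<exists>k\<in>M. ?f k (x + y) \<le> ?f s x + ?f t y" if "s \<in> M" "t \<in> M" for s t x y
    using sublinear_add[OF p, of "x - s" "y - t"] f_add[OF that] M_add[OF that]
    by (intro bexI[of _ "s + t"]) (auto simp: algebra_simps)
  have c: "\<exists>k\<in>M. ?f k (r *\<^sub>R x) \<le> r * ?f s x" if "s \<in> M" "0 < r" for s r x
    using sublinear_scaleR[OF p \<open>0 < r\<close>, of "x - s"] f_scale[of s r] M_scale[of s r] that
    by (intro bexI[of _ "r *\<^sub>R s"]) (auto simp: algebra_simps)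
  have u: "sublinear (\<lambda>x. INF s\<in>M. ?f s x)" "\<And>s x. s \<in> M \<Longrightarrow> (INF s\<in>M. ?f s x) \<le> ?f s x"
    using sublinear_INF[of M "\<lambda>x. - p (- x)" ?f, OF _ b a c] M0 by auto
  obtain q where q: "sublinear q" "\<And>x. q x \<le> (INF s\<in>M. ?f s x)"
    "\<And>r. sublinear r \<Longrightarrow> (\<And>x. r x \<le> q x) \<Longrightarrow> r = q"
    using minimal_sublinear_exists[OF u(1)] by blast
  have add: "q (x + y) = q x + q y" for x y
    by (rule minimal_sublinear_additive[OF q(1) q(3)])
  have neg: "q (- x) = - q x" for x using add[of x "- x"] q(1) by simp
  have "q (r *\<^sub>R x) = r * q x" for r x
  proof -
    consider "r > 0" | "r = 0" | "- r > 0" by linarith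
    then show ?thesis
    proof cases
      case 3
      then have "q (- ((- r) *\<^sub>R x)) = - (- r * q x)" using neg sublinear_scaleR[OF q(1) 3] by metis
      then show ?thesis by simp
    qed (use q(1) sublinear_scaleR in auto)
  qed
  then have "linear q" using add by (intro linearI) auto
  moreover have "f 0 = 0" using f_scale[OF M0, of 0] by simp
  then have "q x \<le> p x" for x using q(2)[of x] u(2)[OF M0, of x] by simp
  moreover have le: "q s \<le> f s" if "s \<in> M" for s using q(2)[of s] u(2)[OF that, of s] p by simp
  then have "q s = f s" if "s \<in> M" for s using le[OF that] le[of "- s"] fm[OF that] neg[of s] by simp
  ultimately show ?thesis using that by blast
qed

section \<open>States\<close>

lemma statesD:
  assumes "f \<in> states S"
  shows "x \<in> S \<Longrightarrow> y \<in> S \<Longrightarrow> f (x + y) = f x + f y" "x \<in> S \<Longrightarrow> f (c *\<^sub>C x) = c * f x"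
    "f 1 = 1" "x \<in> S \<Longrightarrow> cmod (f x) \<le> norm x" "f \<in> extensional S"
  using assms by (auto simp: states_def)

lemma operator_systemD:
  assumes "operator_system S"
  shows "0 \<in> S" "x \<in> S \<Longrightarrow> y \<in> S \<Longrightarrow> x + y \<in> S" "x \<in> S \<Longrightarrow> c *\<^sub>C x \<in> S" "x \<in> S \<Longrightarrow> star x \<in> S" "1 \<in> S"
  using assms by (auto simp: operator_system_def complex_subspace_def)

text \<open>
  The real part of the state is extended, and the complex functional is recovered from its real part.
\<close>

lemma state_extension_exists:
  assumes S: "operator_system S" and w: "\<omega> \<in> states S"
  obtains \<phi> where "state_extension S \<omega> \<phi>"
proof -
  have sub: "sublinear (norm :: 'a \<Rightarrow> real)" by (auto simp: sublinear_def norm_triangle_ineq)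
  have "\<exists>F. linear F \<and> (\<forall>x. F x \<le> norm x) \<and> (\<forall>x\<in>S. F x = Re (\<omega> x))"
  proof (rule Hahn_Banach[OF sub, of S "\<lambda>x. Re (\<omega> x)"])
    show "Re (\<omega> x) \<le> norm x" if "x \<in> S" for x
      using statesD(4)[OF w that] complex_Re_le_cmod[of "\<omega> x"] by linarith
  qed (use operator_systemD[OF S] statesD[OF w] in \<open>auto simp: scaleR_scaleC\<close>)
  then obtain F where F: "linear F" "\<And>x. F x \<le> norm x" "\<And>x. x \<in> S \<Longrightarrow> F x = Re (\<omega> x)" by blast
  define \<phi> where "\<phi> x = Complex (F x) (- F (\<i> *\<^sub>C x))" for x
  have add: "\<phi> (x + y) = \<phi> x + \<phi> y" for x y
    by (simp add: \<phi>_def scaleC_add_right linear_add[OF F(1)] complex_eq_iff)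
  have real: "\<phi> (r *\<^sub>R x) = r * \<phi> x" for r x
  proof -
    have "\<i> *\<^sub>C r *\<^sub>R x = r *\<^sub>R \<i> *\<^sub>C x" by (simp add: scaleR_scaleC scaleC_scaleC mult.commute)
    then show ?thesis by (simp add: \<phi>_def linear_scale[OF F(1)] complex_eq_iff)
  qed
  have imag: "\<phi> (\<i> *\<^sub>C x) = \<i> * \<phi> x" for x
    by (simp add: \<phi>_def scaleC_scaleC scaleC_minus_one linear_neg[OF F(1)] complex_eq_iff)
  have scale: "\<phi> (c *\<^sub>C x) = c * \<phi> x" for c x
  proof -
    have "c *\<^sub>C x = Re c *\<^sub>R x + Im c *\<^sub>R \<i> *\<^sub>C x"
      by (simp add: scaleR_scaleC scaleC_scaleC flip: scaleC_add_left)
        (simp add: complex_eq[symmetric] mult.commute)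
    then show ?thesis by (simp add: add real imag complex_eq_iff)
  qed
  have norm: "cmod (\<phi> x) \<le> norm x" for x
  proof (cases "\<phi> x = 0")
    case False
    \<comment> \<open>Rotating \<open>x\<close> makes its value real, where the bound for the real part applies.\<close>
    define c where "c = cnj (\<phi> x) / cmod (\<phi> x)"
    have c: "cmod c = 1" using False by (simp add: c_def norm_divide)
    have "c * \<phi> x = cmod (\<phi> x)" using False
      by (simp add: c_def mult.commute[of "cnj (\<phi> x)"] complex_norm_square[symmetric] power2_eq_square)
    then have "cmod (\<phi> x) = Re (\<phi> (c *\<^sub>C x))" by (simp add: scale)
    also have "\<dots> \<le> norm (c *\<^sub>C x)" using F(2) by (simp add: \<phi>_def)
    finally show ?thesis using c by (simp add: norm_scaleC)
  qed simp
  have ext: "\<phi> x = \<omega> x" if "x \<in> S" for x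
    using F(3)[OF that] F(3)[OF operator_systemD(3)[OF S that]] statesD(2)[OF w that]
    by (simp add: \<phi>_def complex_eq_iff)
  have "\<phi> 1 = 1" using ext operator_systemD(5)[OF S] statesD(3)[OF w] by simp
  then have "\<phi> \<in> states UNIV" using add scale norm by (simp add: states_def)
  then show ?thesis using that[of \<phi>] ext by (simp add: state_extension_def)
qed

context
  fixes \<phi> :: "'b::unital_cstar_algebra \<Rightarrow> complex"
  assumes \<phi>: "\<phi> \<in> states UNIV"
begin

lemma state_add: "\<phi> (x + y) = \<phi> x + \<phi> y" and state_scaleC: "\<phi> (c *\<^sub>C x) = c * \<phi> x"
  and state_one: "\<phi> 1 = 1" and state_bound: "cmod (\<phi> x) \<le> norm x"
  using statesD[OF \<phi>] by auto

lemma state_zero: "\<phi> 0 = 0"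
  using state_add[of 0 0] by simp

lemma state_minus: "\<phi> (- x) = - \<phi> x"
  using state_scaleC[of "-1" x] by (simp add: scaleC_minus_one)

lemma state_diff: "\<phi> (x - y) = \<phi> x - \<phi> y"
  using state_add[of x "- y"] by (simp add: state_minus)

lemma state_scaleR: "\<phi> (r *\<^sub>R x) = r * \<phi> x"
  by (simp add: scaleR_scaleC state_scaleC)

lemma state_sum: "\<phi> (\<Sum>i\<in>I. f i) = (\<Sum>i\<in>I. \<phi> (f i))"
  by (induction I rule: infinite_finite_induct) (auto simp: state_add state_zero)

text \<open>
  If \<open>\<beta> = Im (\<phi> h)\<close>, then contractivity at \<open>h + i t\<close> gives \<open>(\<beta> + t)\<^sup>2 \<le> (norm h)\<^sup>2 + t\<^sup>2\<close> for all real
  \<open>t\<close>, which is impossible for \<open>\<beta> \<noteq> 0\<close>.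
\<close>

lemma state_hermitian_real:
  assumes "star h = h" shows "Im (\<phi> h) = 0"
proof (rule ccontr)
  let ?b = "Im (\<phi> h)"
  assume b: "?b \<noteq> 0"
  have "?b\<^sup>2 + 2 * ?b * t \<le> (norm h)\<^sup>2" for t :: real
  proof -
    let ?z = "h + (\<i> * t) *\<^sub>C 1"
    have st: "star ?z = h - (\<i> * t) *\<^sub>C 1" using assms by (simp add: star_add star_scaleC scaleC_minus)
    have "(\<i> * t) *\<^sub>C ((\<i> * t) *\<^sub>C (1::'b)) = - (t\<^sup>2 *\<^sub>R 1)"
      by (simp add: scaleC_scaleC scaleR_scaleC power2_eq_square scaleC_minus algebra_simps)
    then have "star ?z * ?z = h * h + t\<^sup>2 *\<^sub>R 1"
      by (subst st) (simp add: algebra_simps mult_scaleC_left mult_scaleC_right scaleC_diff_right)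
    then have "norm ?z ^ 2 \<le> norm (h * h) + t\<^sup>2"
      using cstar_identity[of ?z] norm_triangle_ineq[of "h * h" "t\<^sup>2 *\<^sub>R 1"] by simp
    then have n: "norm ?z ^ 2 \<le> (norm h)\<^sup>2 + t\<^sup>2" by (simp add: norm_square_hermitian[OF assms])
    have "Im (\<phi> ?z) = ?b + t" by (simp add: state_add state_scaleC state_one)
    then have "\<bar>?b + t\<bar> \<le> cmod (\<phi> ?z)" using abs_Im_le_cmod[of "\<phi> ?z"] by simp
    also have "\<dots> \<le> norm ?z" by (rule state_bound)
    finally have "(?b + t)\<^sup>2 \<le> norm ?z ^ 2" using power_mono[of "\<bar>?b + t\<bar>" "norm ?z" 2] by simp
    then show ?thesis using n by (simp add: power2_eq_square algebra_simps)
  qed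
  \<comment> \<open>At this \<open>t\<close> the left-hand side equals \<open>(norm h)\<^sup>2 + 1\<close>.\<close>
  from this[of "((norm h)\<^sup>2 + 1 - ?b\<^sup>2) / (2 * ?b)"] b show False by simp
qed

lemma state_pos_elt:
  assumes "pos_elt a" shows "0 \<le> \<phi> a"
proof -
  obtain t where t: "0 \<le> t" "norm (t *\<^sub>R 1 - a) \<le> t" "star a = a" using assms by (auto simp: pos_elt_def)
  have "cmod (t - \<phi> a) \<le> t"
    using state_bound[of "t *\<^sub>R 1 - a"] t by (simp add: state_diff state_scaleR state_one)
  then have "t - Re (\<phi> a) \<le> t" using complex_Re_le_cmod[of "t - \<phi> a"] by simp
  then show ?thesis using state_hermitian_real[OF t(3)] by (simp add: less_eq_complex_def)
qed

lemma state_nonneg: "0 \<le> \<phi> (star z * z)"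
  by (rule state_pos_elt[OF pos_elt_star_mult_self])

lemma state_star: "\<phi> (star x) = cnj (\<phi> x)"
proof -
  obtain a b where ab: "star a = a" "star b = b" "x = a + \<i> *\<^sub>C b" by (rule hermitian_decomposition)
  then have "star x = a + (- \<i>) *\<^sub>C b" by (simp add: star_add star_scaleC)
  then show ?thesis
    using ab state_hermitian_real[OF ab(1)] state_hermitian_real[OF ab(2)]
    by (simp add: state_add state_scaleC complex_eq_iff)
qed

end

section \<open>Positive semidefinite matrices as forms\<close>

text \<open>
  The sesquilinear form of a matrix, conjugate linear in the first argument. Vectors are functions, of
  which only the values below \<open>n\<close> matter; this keeps sums and linear combinations free of carrier
  conditions.
\<close>

definition sform :: "nat \<Rightarrow> complex mat \<Rightarrow> (nat \<Rightarrow> complex) \<Rightarrow> (nat \<Rightarrow> complex) \<Rightarrow> complex" where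
  "sform n M u v = (\<Sum>i<n. cnj (u i) * (\<Sum>j<n. M $$ (i, j) * v j))"

lemma sform_add_right: "sform n M u (\<lambda>i. v i + w i) = sform n M u v + sform n M u w"
  and sform_add_left: "sform n M (\<lambda>i. v i + w i) u = sform n M v u + sform n M w u"
  and sform_diff_right: "sform n M u (\<lambda>i. v i - w i) = sform n M u v - sform n M u w"
  and sform_diff_left: "sform n M (\<lambda>i. v i - w i) u = sform n M v u - sform n M w u"
  by (simp_all add: sform_def algebra_simps sum.distrib sum_subtractf sum_distrib_left)

lemma sform_scale_right: "sform n M u (\<lambda>i. c * v i) = c * sform n M u v"
  and sform_scale_left: "sform n M (\<lambda>i. c * v i) u = cnj c * sform n M v u"
  by (simp_all add: sform_def algebra_simps sum_distrib_left)

lemma sform_sum_right: "sform n M u (\<lambda>i. \<Sum>k\<in>I. v k i) = (\<Sum>k\<in>I. sform n M u (v k))"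
  by (induction I rule: infinite_finite_induct) (auto simp: sform_add_right, auto simp: sform_def)

lemma sform_sum_left: "sform n M (\<lambda>i. \<Sum>k\<in>I. v k i) u = (\<Sum>k\<in>I. sform n M (v k) u)"
  by (induction I rule: infinite_finite_induct) (auto simp: sform_add_left, auto simp: sform_def)

lemma sform_cong:
  "(\<And>i. i < n \<Longrightarrow> u i = u' i) \<Longrightarrow> (\<And>i. i < n \<Longrightarrow> v i = v' i) \<Longrightarrow> sform n M u v = sform n M u' v'"
  by (auto simp: sform_def intro!: sum.cong)

lemma sform_unit_left:
  "i < n \<Longrightarrow> sform n M (\<lambda>k. if k = i then 1 else 0) v = (\<Sum>j<n. M $$ (i, j) * v j)"
  by (simp add: sform_def if_distrib if_distribR sum.delta cong: if_cong)

lemma psd_mat_iff: "psd_mat n M \<longleftrightarrow> M \<in> carrier_mat n n \<and> (\<forall>v. 0 \<le> sform n M v v)"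
proof -
  have form: "(M *\<^sub>v v) \<bullet>c v = sform n M (($) v) (($) v)"
    if "M \<in> carrier_mat n n" "v \<in> carrier_vec n" for v
    using that by (auto simp: scalar_prod_def sform_def atLeast0LessThan mult.commute intro!: sum.cong)
  show ?thesis
  proof (intro iffI conjI allI)
    assume M: "psd_mat n M"
    then show c: "M \<in> carrier_mat n n" by (simp add: psd_mat_def)
    fix v :: "nat \<Rightarrow> complex"
    have "sform n M v v = sform n M (($) (vec n v)) (($) (vec n v))" by (rule sform_cong) auto
    moreover have "vec n v \<in> carrier_vec n" by simp
    ultimately show "0 \<le> sform n M v v" using M form[OF c, of "vec n v"] unfolding psd_mat_def by metis
  qed (auto simp: psd_mat_def form)
qed

text \<open>
Polarization: the form is real on the diagonal, in particular at \<open>u + v\<close> and at \<open>u + i v\<close>.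
\<close>

lemma psd_form_hermitian:
  assumes "psd_mat n M" shows "sform n M v u = cnj (sform n M u v)"
proof -
  have im: "Im (sform n M w w) = 0" for w
    using assms unfolding psd_mat_iff less_eq_complex_def by simp
  have "Im (sform n M u v) + Im (sform n M v u) = 0"
    using im[of "\<lambda>i. u i + v i"] im[of u] im[of v]
    by (simp add: sform_add_left sform_add_right)
  moreover have "Re (sform n M u v) - Re (sform n M v u) = 0"
    using im[of "\<lambda>i. u i + \<i> * v i"] im[of u] im[of v]
    by (simp add: sform_add_left sform_add_right sform_scale_left sform_scale_right)
  ultimately show ?thesis by (simp add: complex_eq_iff)
qed

text \<open>
  The degenerate case of the Cauchy-Schwarz inequality: moving from \<open>v\<close> a small step towards \<open>u\<close>, in the
  appropriate phase, would make the form negative.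
\<close>

lemma psd_null_vector:
  assumes M: "psd_mat n M" and v: "sform n M v v = 0"
  shows "sform n M u v = 0"
proof (rule ccontr)
  define c where "c = sform n M u v"
  define a where "a = Re (sform n M u u)"
  assume "sform n M u v \<noteq> 0"
  then have c: "c \<noteq> 0" by (simp add: c_def)
  have pos: "0 \<le> Re (sform n M w w)" "Im (sform n M w w) = 0" for w
    using M unfolding psd_mat_iff less_eq_complex_def by auto
  have uu: "sform n M u u = of_real a" using pos(2)[of u] by (simp add: a_def complex_eq_iff)
  have vu: "sform n M v u = cnj c" unfolding c_def by (rule psd_form_hermitian[OF M])
  define t where "t = 1 / (a + 1)"
  have a: "0 \<le> a" unfolding a_def by (rule pos)
  define s where "s = of_real t * cnj c"
  have "sform n M (\<lambda>i. v i - cnj s * u i) (\<lambda>i. v i - cnj s * u i)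
      = - (cnj s * cnj c) - s * c + s * cnj s * of_real a"
    unfolding sform_diff_left sform_diff_right sform_scale_left sform_scale_right v uu vu c_def[symmetric]
    by (simp add: algebra_simps)
  also have "\<dots> = (c * cnj c) * of_real (t * (t * a - 2))"
    by (simp add: s_def algebra_simps)
  also have "\<dots> = of_real ((cmod c)\<^sup>2 * (t * (t * a - 2)))"
    by (simp only: complex_norm_square[symmetric] of_real_mult)
  finally have "0 \<le> (cmod c)\<^sup>2 * (t * (t * a - 2))"
    using pos(1)[of "\<lambda>i. v i - cnj s * u i"] by simp
  moreover have "t * a - 2 < 0" "0 < t" using a by (auto simp: t_def field_simps)
  then have "(cmod c)\<^sup>2 * (t * (t * a - 2)) < 0" using c by (intro mult_pos_neg) auto
  ultimately show False by simp
qed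

lemma psd_null_kernel:
  assumes "psd_mat n M" "sform n M v v = 0" "i < n"
  shows "(\<Sum>j<n. M $$ (i, j) * v j) = 0"
  using psd_null_vector[OF assms(1,2)] sform_unit_left[OF assms(3)] by metis

section \<open>Vector states are matrix states\<close>

text \<open>
  In the GNS representation of \<open>\<phi>\<close> this is the compression of \<open>x\<close> to the vectors given by the \<open>e p\<close>.
\<close>

definition vector_compression ::
    "('b::unital_cstar_algebra \<Rightarrow> complex) \<Rightarrow> nat \<Rightarrow> (nat \<Rightarrow> 'b) \<Rightarrow> 'b \<Rightarrow> complex mat" where
  "vector_compression \<phi> n e x = mat n n (\<lambda>(p, q). \<phi> (star (e p) * x * e q))"

text \<open>
  If \<open>X = Y\<^sup>* Y\<close>, then the form of the amplified matrix at \<open>v\<close> is the sum of \<open>\<phi> (z\<^sub>r\<^sup>* z\<^sub>r)\<close> over the rows \<open>r\<close>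
  of \<open>Y\<close>, where \<open>z\<^sub>r\<close> collects the entries of that row with coefficients from \<open>v\<close>.
\<close>

lemma amplified_compression_psd:
  assumes \<phi>: "\<phi> \<in> states UNIV" and X: "positive_mat k X"
  shows "psd_mat (k * n) (amplification k n (vector_compression \<phi> n e) X)" (is "psd_mat _ ?M")
  unfolding psd_mat_iff
proof (intro conjI allI)
  show "?M \<in> carrier_mat (k * n) (k * n)" by (simp add: amplification_def)
  fix v :: "nat \<Rightarrow> complex"
  obtain Y where Y: "Y \<in> carrier_mat k k" "X = star_mat Y * Y" using X by (auto simp: positive_mat_def)
  have X_index: "X $$ (a, b) = (\<Sum>r<k. star (Y $$ (r, a)) * Y $$ (r, b))" if "a < k" "b < k" for a b
    using that Y by (simp add: star_mat_def scalar_prod_def atLeast0LessThan)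
  let ?w = "\<lambda>r j. Y $$ (r, j div n) * e (j mod n)"
  define z where "z r = (\<Sum>j<k*n. v j *\<^sub>C ?w r j)" for r
  have M_index: "?M $$ (i, j) = (\<Sum>r<k. \<phi> (star (?w r i) * ?w r j))" if "i < k * n" "j < k * n" for i j
  proof -
    have n: "0 < n" using that by (cases n) auto
    then have "i div n < k" "j div n < k" using that by (auto simp: less_mult_imp_div_less)
    moreover have "i mod n < n" "j mod n < n" using n by auto
    ultimately show ?thesis using that
      by (simp add: amplification_def vector_compression_def X_index sum_distrib_left sum_distrib_right
          state_sum[OF \<phi>] star_mult mult.assoc)
  qed
  have "sform (k * n) ?M v v = (\<Sum>i<k*n. cnj (v i) * (\<Sum>j<k*n. (\<Sum>r<k. \<phi> (star (?w r i) * ?w r j)) * v j))"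
    by (simp add: sform_def M_index)
  also have "\<dots> = (\<Sum>i<k*n. \<Sum>j<k*n. \<Sum>r<k. cnj (v i) * (v j * \<phi> (star (?w r i) * ?w r j)))"
    by (simp add: sum_distrib_left sum_distrib_right mult_ac)
  also have "\<dots> = (\<Sum>i<k*n. \<Sum>r<k. \<Sum>j<k*n. cnj (v i) * (v j * \<phi> (star (?w r i) * ?w r j)))"
    by (intro sum.cong refl sum.swap)
  also have "\<dots> = (\<Sum>r<k. \<Sum>i<k*n. \<Sum>j<k*n. cnj (v i) * (v j * \<phi> (star (?w r i) * ?w r j)))"
    by (rule sum.swap)
  also have "\<dots> = (\<Sum>r<k. \<phi> (star (z r) * z r))"
  proof (rule sum.cong[OF refl])
    fix r
    have "star (z r) * z r = (\<Sum>i<k*n. \<Sum>j<k*n. (cnj (v i) *\<^sub>C star (?w r i)) * (v j *\<^sub>C ?w r j))"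
      by (simp only: z_def star_sum star_scaleC sum_product)
    also have "\<dots> = (\<Sum>i<k*n. \<Sum>j<k*n. cnj (v i) *\<^sub>C v j *\<^sub>C (star (?w r i) * ?w r j))"
      by (simp add: mult_scaleC_left mult_scaleC_right scaleC_scaleC mult.commute)
    finally show "(\<Sum>i<k*n. \<Sum>j<k*n. cnj (v i) * (v j * \<phi> (star (?w r i) * ?w r j))) = \<phi> (star (z r) * z r)"
      by (simp only: state_sum[OF \<phi>] state_scaleC[OF \<phi>])
  qed
  finally show "0 \<le> sform (k * n) ?M v v"
    using state_nonneg[OF \<phi>] by (simp add: sum_nonneg)
qed

lemma vector_compression_matrix_state:
  assumes S: "operator_system S" and \<phi>: "\<phi> \<in> states UNIV"
    and e: "\<And>p q. p < n \<Longrightarrow> q < n \<Longrightarrow> \<phi> (star (e p) * e q) = (if p = q then 1 else 0)"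
  shows "(\<lambda>x\<in>S. vector_compression \<phi> n e x) \<in> matrix_states S n" (is "?\<psi> \<in> _")
proof -
  have "amplification k n ?\<psi> X = amplification k n (vector_compression \<phi> n e) X"
    if "X \<in> carrier_mat k k" "elements_mat X \<subseteq> S" for k X
  proof -
    have "X $$ (i div n, j div n) \<in> S" if "i < k * n" "j < k * n" for i j
      using \<open>X \<in> carrier_mat k k\<close> \<open>elements_mat X \<subseteq> S\<close> that
      by (intro subsetD[OF \<open>elements_mat X \<subseteq> S\<close>] elements_matI) (auto simp: less_mult_imp_div_less)
    then show ?thesis unfolding amplification_def by (intro eq_matI) auto
  qed
  then have pos: "psd_mat (k * n) (amplification k n ?\<psi> X)"
    if "X \<in> carrier_mat k k" "elements_mat X \<subseteq> S" "positive_mat k X" for k X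
    using that amplified_compression_psd[OF \<phi>] by simp
  have "vector_compression \<phi> n e (x + y) = vector_compression \<phi> n e x + vector_compression \<phi> n e y" for x y
    by (intro eq_matI) (auto simp: vector_compression_def distrib_left distrib_right state_add[OF \<phi>])
  moreover have "vector_compression \<phi> n e (c *\<^sub>C x) = c \<cdot>\<^sub>m vector_compression \<phi> n e x" for c x
    by (intro eq_matI) (auto simp: vector_compression_def mult_scaleC_left mult_scaleC_right state_scaleC[OF \<phi>])
  ultimately have "completely_positive S n ?\<psi>"
    using pos operator_systemD[OF S] by (simp add: completely_positive_def)
  moreover have "vector_compression \<phi> n e 1 = 1\<^sub>m n"
    by (intro eq_matI) (auto simp: vector_compression_def e)
  ultimately show ?thesis
    using operator_systemD(5)[OF S] by (auto simp: matrix_states_def vector_compression_def)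
qed

lemma state_matrix_state:
  assumes S: "operator_system S" and f: "f \<in> states S"
  shows "(\<lambda>x\<in>S. mat 1 1 (\<lambda>_. f x)) \<in> matrix_states S 1"
proof -
  obtain \<phi> where \<phi>: "state_extension S f \<phi>" using state_extension_exists[OF S f] .
  then have st: "\<phi> \<in> states UNIV" by (simp add: state_extension_def)
  have "(\<lambda>x\<in>S. vector_compression \<phi> 1 (\<lambda>_. 1) x) \<in> matrix_states S 1"
    by (rule vector_compression_matrix_state[OF S st]) (simp add: state_one[OF st])
  moreover have "(\<lambda>x\<in>S. vector_compression \<phi> 1 (\<lambda>_. 1) x) = (\<lambda>x\<in>S. mat 1 1 (\<lambda>_. f x))"
    using \<phi> by (intro restrict_ext eq_matI) (auto simp: vector_compression_def state_extension_def)
  ultimately show ?thesis by simp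
qed

text \<open>
  The block is \<open>Y\<^sup>* Y\<close> for the upper triangular \<open>Y = [1, x; 0, s]\<close> with \<open>s\<^sup>2 = 1 - x\<^sup>* x\<close>. Through this
  block, complete positivity of a unital functional implies contractivity.
\<close>

lemma positive_unit_block:
  assumes x: "norm (x::'b::unital_cstar_algebra) \<le> 1"
  shows "positive_mat 2 (mat 2 2 (\<lambda>(i, j). if i = j then 1 else if i = 0 then x else star x))"
proof -
  have "norm (star x * x) \<le> 1" using x by (simp add: cstar_identity power_le_one)
  moreover have "star (star x * x) = star x * x" by (simp add: star_mult star_star)
  ultimately obtain s where s: "star s = s" "s * s = 1 - star x * x"
    using hermitian_sqrt_exists[of "star x * x"] by blast
  let ?Y = "mat 2 2 (\<lambda>(i, j). if j = 0 then (if i = 0 then 1 else 0) else (if i = 0 then x else s))"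
  have "mat 2 2 (\<lambda>(i, j). if i = j then 1 else if i = 0 then x else star x) = star_mat ?Y * ?Y"
    by (rule eq_matI)
      (auto simp: star_mat_def scalar_prod_def less_2_cases_iff s numeral_2_eq_2)
  then show ?thesis unfolding positive_mat_def by (intro bexI[of _ ?Y]) auto
qed

lemma psd_unit_block:
  assumes M: "psd_mat 2 M" and d: "M $$ (0, 0) = 1" "M $$ (1, 1) = 1"
  shows "cmod (M $$ (0, 1)) \<le> 1"
proof -
  let ?u = "\<lambda>i::nat. if i = 0 then 1 else 0 :: complex" and ?v = "\<lambda>i::nat. if i = 0 then 0 else 1 :: complex"
  let ?a = "M $$ (0, 1)"
  have uv: "sform 2 M ?u ?v = ?a" "sform 2 M ?v ?u = M $$ (1, 0)"
    by (simp_all add: sform_def numeral_2_eq_2)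
  then have b: "M $$ (1, 0) = cnj ?a" using psd_form_hermitian[OF M, of ?v ?u] by simp
  let ?w = "\<lambda>i::nat. if i = 0 then - ?a else 1"
  have "sform 2 M ?w ?w = 1 - cnj ?a * ?a" using d b by (simp add: sform_def numeral_2_eq_2)
  moreover have "0 \<le> sform 2 M ?w ?w" using M by (simp add: psd_mat_iff)
  moreover have "1 - cnj ?a * ?a = of_real (1 - (cmod ?a)\<^sup>2)"
    using complex_norm_square[of ?a] by (simp add: mult.commute)
  ultimately have "0 \<le> complex_of_real (1 - (cmod ?a)\<^sup>2)" by metis
  then have "(cmod ?a)\<^sup>2 \<le> 1\<^sup>2" unfolding less_eq_complex_def Re_complex_of_real by simp
  then show ?thesis by (rule power2_le_imp_le) simp
qed

lemma matrix_state_state: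
  assumes S: "operator_system S" and \<psi>: "\<psi> \<in> matrix_states S 1"
  shows "(\<lambda>x\<in>S. \<psi> x $$ (0, 0)) \<in> states S"
proof -
  have cp: "completely_positive S 1 \<psi>" and one: "\<psi> 1 = 1\<^sub>m 1" and c: "\<And>x. x \<in> S \<Longrightarrow> \<psi> x \<in> carrier_mat 1 1"
    using \<psi> by (auto simp: matrix_states_def)
  let ?f = "\<lambda>x. \<psi> x $$ (0, 0)"
  have add: "?f (x + y) = ?f x + ?f y" if "x \<in> S" "y \<in> S" for x y
    using cp c[OF that(1)] c[OF that(2)] that by (simp add: completely_positive_def)
  have scale: "?f (a *\<^sub>C x) = a * ?f x" if "x \<in> S" for a x
    using cp c[OF that] that by (simp add: completely_positive_def)
  have le1: "cmod (?f x) \<le> 1" if x: "x \<in> S" "norm x \<le> 1" for x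
  proof -
    let ?X = "mat 2 2 (\<lambda>(i, j). if i = j then 1 else if i = 0 then x else star x)"
    have "elements_mat ?X \<subseteq> S" using operator_systemD(4,5)[OF S] x by (auto elim!: elements_matD simp: elements_mat_def)
    then have psd: "psd_mat (2 * 1) (amplification 2 1 \<psi> ?X)"
      using cp positive_unit_block[OF x(2)] unfolding completely_positive_def by auto
    have "cmod (amplification 2 1 \<psi> ?X $$ (0, 1)) \<le> 1"
      using psd by (intro psd_unit_block) (auto simp: amplification_def one)
    then show ?thesis by (simp add: amplification_def)
  qed
  have "cmod (?f x) \<le> norm x" if x: "x \<in> S" for x
  proof (cases "norm x = 0")
    case True
    then show ?thesis using scale[OF operator_systemD(1)[OF S], of 0] by simp
  next
    case False
    let ?y = "(1 / norm x) *\<^sub>C x"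
    have "cmod (?f ?y) \<le> 1"
      using False x by (intro le1 operator_systemD[OF S]) (auto simp: norm_scaleC norm_divide)
    then show ?thesis using False by (simp add: scale[OF x] norm_mult norm_divide field_simps)
  qed
  then show ?thesis
    using add scale operator_systemD[OF S] by (simp add: states_def one)
qed

section \<open>Forms dominated by a positive semidefinite form\<close>

abbreviation unit_fun :: "nat \<Rightarrow> nat \<Rightarrow> complex" where
  "unit_fun a \<equiv> (\<lambda>i. if i = a then 1 else 0)"

text \<open>
What is left of \<open>v\<close> after subtracting its components along \<open>f 0, \<dots>, f (m - 1)\<close>.
\<close>

definition residual ::
    "nat \<Rightarrow> complex mat \<Rightarrow> nat \<Rightarrow> (nat \<Rightarrow> nat \<Rightarrow> complex) \<Rightarrow> (nat \<Rightarrow> complex) \<Rightarrow> nat \<Rightarrow> complex" where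
  "residual d L m f v = (\<lambda>i. v i - (\<Sum>k<m. sform d L (f k) v * f k i))"

lemma sform_residual:
  "sform d M u (residual d L m f v) = sform d M u v - (\<Sum>k<m. sform d L (f k) v * sform d M u (f k))"
  unfolding residual_def by (simp only: sform_diff_right sform_sum_right sform_scale_right)

definition orthonormal_family ::
    "nat \<Rightarrow> complex mat \<Rightarrow> nat \<Rightarrow> (nat \<Rightarrow> nat \<Rightarrow> complex) \<Rightarrow> bool" where
  "orthonormal_family d L m f \<longleftrightarrow> (\<forall>j<m. \<forall>k<m. sform d L (f j) (f k) = (if j = k then 1 else 0))"

lemma orthonormal_sum:
  assumes "orthonormal_family d L m f" "j < m"
  shows "(\<Sum>k<m. x k * sform d L (f j) (f k)) = x j"
proof -
  have "(\<Sum>k<m. x k * sform d L (f j) (f k)) = (\<Sum>k<m. if j = k then x k else 0)"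
    using assms by (intro sum.cong refl) (simp add: orthonormal_family_def)
  then show ?thesis using assms(2) by simp
qed

text \<open>
  The form may be degenerate, so the unit vectors are recovered from the orthonormal family only
  up to null vectors.
\<close>

lemma gram_schmidt_psd:
  assumes L: "psd_mat d L"
  obtains m f where "orthonormal_family d L m f"
    "\<And>a u. a < n \<Longrightarrow> sform d L u (residual d L m f (unit_fun a)) = 0"
proof -
  have "\<exists>m f. orthonormal_family d L m f \<and> (\<forall>a<n. \<forall>u. sform d L u (residual d L m f (unit_fun a)) = 0)"
  proof (induction n)
    case 0
    show ?case by (intro exI[of _ 0] exI) (simp add: orthonormal_family_def)
  next
    case (Suc n)
    let ?S = "sform d L"
    obtain m f where orth: "orthonormal_family d L m f"
      and null: "\<And>a u. a < n \<Longrightarrow> ?S u (residual d L m f (unit_fun a)) = 0"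
      using Suc.IH by blast
    define r where "r = residual d L m f (unit_fun n)"
    have fr: "?S (f j) r = 0" if "j < m" for j
      unfolding r_def sform_residual orthonormal_sum[OF orth that] by simp
    have rf: "?S r (f j) = 0" if "j < m" for j
      using fr[OF that] psd_form_hermitian[OF L, of r "f j"] by simp
    have r_res: "?S r (residual d L m f v) = ?S r v" for v
      by (simp add: sform_residual rf)
    show ?case
    proof (cases "?S r r = 0")
      case True
      \<comment> \<open>The new residual is null, and the family need not be enlarged.\<close>
      have "?S u (residual d L m f (unit_fun a)) = 0" if "a < Suc n" for a u
        using that null psd_null_vector[OF L True] by (cases "a = n") (auto simp: r_def)
      then show ?thesis using orth by blast
    next
      case False
      define \<rho> where "\<rho> = Re (?S r r)"
      have "0 \<le> ?S r r" using L by (simp add: psd_mat_iff)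
      then have S_rr: "?S r r = of_real \<rho>" and \<rho>: "0 < \<rho>"
        using False by (auto simp: \<rho>_def less_eq_complex_def complex_eq_iff)
      define c where "c = complex_of_real (1 / sqrt \<rho>)"
      have cc: "cnj c = c" by (simp add: c_def)
      have "1 / sqrt \<rho> * (1 / sqrt \<rho>) * \<rho> = 1" using \<rho> by (simp add: field_simps)
      then have c\<rho>: "c * c * of_real \<rho> = 1" unfolding c_def by (simp only: of_real_mult[symmetric] of_real_1)
      define h where "h = (\<lambda>i. c * r i)"
      define f' where "f' = f(m := h)"
      have hh: "?S h h = 1" unfolding h_def sform_scale_left sform_scale_right cc S_rr
        using c\<rho> by (simp only: mult.assoc)
      have fh: "?S (f j) h = 0" "?S h (f j) = 0" if "j < m" for j
        unfolding h_def sform_scale_left sform_scale_right using fr[OF that] rf[OF that] by simp_all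
      have orth': "orthonormal_family d L (Suc m) f'"
        using orth hh fh by (simp add: orthonormal_family_def f'_def less_Suc_eq all_conj_distrib)
      have split: "residual d L (Suc m) f' v = (\<lambda>i. residual d L m f v i - ?S h v * h i)" for v
        by (simp add: residual_def f'_def fun_eq_iff)
      have "?S u (residual d L (Suc m) f' (unit_fun a)) = 0" if "a < Suc n" for a u
      proof (cases "a = n")
        case True
        have "?S r (unit_fun n) = of_real \<rho>" using r_res[of "unit_fun n"] S_rr by (simp add: r_def)
        then have "?S h (unit_fun n) * h i = (c * c * of_real \<rho>) * r i" for i
          unfolding h_def sform_scale_left cc by (simp only: mult_ac)
        then show ?thesis unfolding split True c\<rho> by (simp add: r_def sform_def)
      next
        case False
        then have a: "a < n" using that by simp
        have "?S h (unit_fun a) = cnj c * ?S r (residual d L m f (unit_fun a))"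
          unfolding h_def sform_scale_left r_res ..
        then have "?S h (unit_fun a) = 0" using null[OF a] by simp
        then show ?thesis unfolding split using null[OF a] by simp
      qed
      then show ?thesis using orth' by blast
    qed
  qed
  then show ?thesis using that by blast
qed

text \<open>
  Finite dimension enters here. Modulo null vectors, \<open>v\<close> is a combination of finitely many
  \<open>L\<close>-orthonormal vectors \<open>f k\<close> with coefficients \<open>b k\<close>, and null vectors do not contribute to \<open>N\<close>.
  So \<open>N\<close> is bounded by the products of the \<open>b k\<close>, and \<open>L\<close> is the sum of their squares.
\<close>

lemma form_dominated:
  assumes L: "psd_mat d L"
    and N: "\<And>u v. sform d N v u = cnj (sform d N u v)"
    and ker: "\<And>w u. (\<And>u. sform d L u w = 0) \<Longrightarrow> sform d N u w = 0"
  obtains C where "0 \<le> C" "\<And>v. cmod (sform d N v v) \<le> C * Re (sform d L v v)"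
proof -
  obtain m f where orth: "orthonormal_family d L m f"
    and null: "\<And>a u. a < d \<Longrightarrow> sform d L u (residual d L m f (unit_fun a)) = 0"
    using gram_schmidt_psd[OF L, of d] by blast
  let ?C = "\<Sum>j<m. \<Sum>k<m. cmod (sform d N (f j) (f k))"
  have "cmod (sform d N v v) \<le> ?C * Re (sform d L v v)" for v
  proof -
    define b where "b k = sform d L (f k) v" for k
    define g where "g = (\<lambda>i. \<Sum>k<m. b k * f k i)"
    define w where "w = residual d L m f v"
    have v_sum: "sform d M u v = (\<Sum>a<d. v a * sform d M u (unit_fun a))" for M u
    proof -
      have "sform d M u v = sform d M u (\<lambda>i. \<Sum>a<d. v a * unit_fun a i)"
        by (rule sform_cong) (simp_all add: if_distrib cong: if_cong)
      then show ?thesis by (simp only: sform_sum_right sform_scale_right)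
    qed
    have Lw: "sform d L u w = 0" for u
    proof -
      let ?x = "\<lambda>k a. sform d L (f k) (unit_fun a)" and ?y = "\<lambda>k. sform d L u (f k)"
      have "(\<Sum>k<m. sform d L (f k) v * ?y k) = (\<Sum>k<m. \<Sum>a<d. v a * (?x k a * ?y k))"
        by (subst v_sum) (simp only: sum_distrib_right mult.assoc)
      also have "\<dots> = (\<Sum>a<d. v a * (\<Sum>k<m. ?x k a * ?y k))"
        by (subst sum.swap) (simp only: sum_distrib_left)
      finally have "sform d L u w = (\<Sum>a<d. v a * sform d L u (unit_fun a)) - (\<Sum>a<d. v a * (\<Sum>k<m. ?x k a * ?y k))"
        unfolding w_def sform_residual by (simp only: v_sum[of L u])
      also have "\<dots> = (\<Sum>a<d. v a * sform d L u (residual d L m f (unit_fun a)))"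
        by (simp only: sform_residual right_diff_distrib sum_subtractf)
      also have "\<dots> = 0" using null by simp
      finally show ?thesis .
    qed
    have Nw: "sform d N u w = 0" "sform d N w u = 0" for u
      using ker[OF Lw] N[of w u] by simp_all
    have wL: "sform d L w u = 0" for u
      using Lw psd_form_hermitian[OF L, of w u] by simp
    have v: "v = (\<lambda>i. g i + w i)" by (simp add: w_def residual_def g_def b_def)
    have Nv: "sform d N v v = sform d N g g"
      by (subst (1 2) v) (simp add: sform_add_left sform_add_right Nw)
    have "sform d L v v = sform d L g g"
      by (subst (1 2) v) (simp add: sform_add_left sform_add_right Lw wL)
    also have "\<dots> = (\<Sum>k<m. cnj (b k) * b k)"
      unfolding g_def sform_sum_left sform_sum_right sform_scale_left sform_scale_right
      by (intro sum.cong refl) (simp add: sum_distrib_left[symmetric] orthonormal_sum[OF orth])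
    also have "\<dots> = of_real (\<Sum>k<m. (cmod (b k))\<^sup>2)"
      unfolding of_real_sum using complex_norm_square by (simp add: mult.commute)
    finally have Lv: "Re (sform d L v v) = (\<Sum>k<m. (cmod (b k))\<^sup>2)" by simp
    have b_le: "cmod (b j) * cmod (b k) \<le> Re (sform d L v v)" if "j < m" "k < m" for j k
    proof -
      have le: "(cmod (b l))\<^sup>2 \<le> Re (sform d L v v)" if "l < m" for l
        unfolding Lv using that by (intro member_le_sum) auto
      have "(cmod (b j))\<^sup>2 + (cmod (b k))\<^sup>2 \<le> 2 * Re (sform d L v v)"
        using le[OF that(1)] le[OF that(2)] by simp
      moreover have "2 * (cmod (b j) * cmod (b k)) \<le> (cmod (b j))\<^sup>2 + (cmod (b k))\<^sup>2"
        using sum_squares_bound[of "cmod (b j)" "cmod (b k)"] by simp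
      ultimately show ?thesis by simp
    qed
    have "cmod (sform d N g g) \<le> (\<Sum>j<m. \<Sum>k<m. cmod (b j) * cmod (b k) * cmod (sform d N (f j) (f k)))"
      unfolding g_def sform_sum_left sform_sum_right sform_scale_left sform_scale_right
      by (intro sum_norm_le) (auto simp: norm_mult sum_distrib_left mult_ac intro!: sum_norm_le)
    also have "\<dots> \<le> (\<Sum>j<m. \<Sum>k<m. Re (sform d L v v) * cmod (sform d N (f j) (f k)))"
      using b_le by (intro sum_mono mult_right_mono) auto
    also have "\<dots> = ?C * Re (sform d L v v)" by (simp add: sum_distrib_left mult.commute)
    finally show ?thesis unfolding Nv .
  qed
  then show ?thesis by (intro that[of ?C] sum_nonneg) auto
qed

section \<open>Extreme points of free spectrahedra\<close>

definition linear_pencil :: "nat \<Rightarrow> nat \<Rightarrow> (nat \<Rightarrow> complex mat) \<Rightarrow> (nat \<Rightarrow> complex) \<Rightarrow> complex mat" where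
  "linear_pencil d g A c = mat d d (\<lambda>(i, j). \<Sum>k<g. c k * A k $$ (i, j))"

text \<open>
A point of \<open>\<complex>\<^sup>g\<close> as a tuple of matrices of size 1.
\<close>

definition point_tuple :: "nat \<Rightarrow> (nat \<Rightarrow> complex) \<Rightarrow> nat \<Rightarrow> complex mat" where
  "point_tuple g c = (\<lambda>k\<in>{..<g}. mat 1 1 (\<lambda>_. c k))"

lemma sform_linear_pencil:
  "sform d (linear_pencil d g A c) u v = (\<Sum>k<g. c k * sform d (A k) u v)"
proof -
  have "sform d (linear_pencil d g A c) u v = (\<Sum>i<d. \<Sum>j<d. \<Sum>k<g. c k * (cnj (u i) * (A k $$ (i, j) * v j)))"
    by (simp add: sform_def linear_pencil_def sum_distrib_left sum_distrib_right mult_ac)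
  also have "\<dots> = (\<Sum>i<d. \<Sum>k<g. \<Sum>j<d. c k * (cnj (u i) * (A k $$ (i, j) * v j)))"
    by (intro sum.cong refl sum.swap)
  also have "\<dots> = (\<Sum>k<g. \<Sum>i<d. \<Sum>j<d. c k * (cnj (u i) * (A k $$ (i, j) * v j)))"
    by (rule sum.swap)
  finally show ?thesis by (simp add: sform_def sum_distrib_left)
qed

lemma sform_one_minus:
  assumes "M \<in> carrier_mat d d"
  shows "sform d (1\<^sub>m d - M) u v = (\<Sum>i<d. cnj (u i) * v i) - sform d M u v"
proof -
  have "(\<Sum>j<d. (1\<^sub>m d - M) $$ (i, j) * v j) = v i - (\<Sum>j<d. M $$ (i, j) * v j)" if "i < d" for i
  proof -
    have "(\<Sum>j<d. (1\<^sub>m d - M) $$ (i, j) * v j) = (\<Sum>j<d. (if i = j then v j else 0) - M $$ (i, j) * v j)"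
      using assms that by (intro sum.cong refl) (simp add: left_diff_distrib)
    then show ?thesis using that by (simp add: sum_subtractf)
  qed
  then show ?thesis by (simp add: sform_def right_diff_distrib sum_subtractf)
qed

lemma mat_adjoint_index:
  "i < dim_col M \<Longrightarrow> j < dim_row M \<Longrightarrow> mat_adjoint M $$ (i, j) = cnj (M $$ (j, i))"
  by (simp add: mat_adjoint_def mat_of_rows_def)

lemma mat_adjoint_dim [simp]:
  "dim_row (mat_adjoint M) = dim_col M" "dim_col (mat_adjoint M) = dim_row M"
  by (simp_all add: mat_adjoint_def)

lemma hermitian_mat_index:
  "hermitian_mat M \<Longrightarrow> M \<in> carrier_mat n n \<Longrightarrow> i < n \<Longrightarrow> j < n \<Longrightarrow> cnj (M $$ (i, j)) = M $$ (j, i)"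
  using mat_adjoint_index[of j M i] by (simp add: hermitian_mat_def)

lemma hermitian_form:
  assumes "hermitian_mat M" "M \<in> carrier_mat n n"
  shows "sform n M v u = cnj (sform n M u v)"
proof -
  have "cnj (sform n M u v) = (\<Sum>i<n. \<Sum>j<n. u i * (cnj (M $$ (i, j)) * cnj (v j)))"
    by (simp add: sform_def sum_distrib_left)
  also have "\<dots> = (\<Sum>i<n. \<Sum>j<n. u i * (M $$ (j, i) * cnj (v j)))"
    by (intro sum.cong refl) (simp add: hermitian_mat_index[OF assms])
  also have "\<dots> = (\<Sum>j<n. \<Sum>i<n. u i * (M $$ (j, i) * cnj (v j)))" by (rule sum.swap)
  finally show ?thesis by (simp add: sform_def sum_distrib_left mult_ac)
qed

lemma point_tuple_in_spectrahedron:
  assumes "\<And>k. k < g \<Longrightarrow> Im (c k) = 0"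
  shows "point_tuple g c \<in> free_spectrahedron d g A 1 \<longleftrightarrow> psd_mat d (1\<^sub>m d - linear_pencil d g A c)"
proof -
  have "hermitian_mat (mat 1 1 (\<lambda>_. c k))" if "k < g" for k
    unfolding hermitian_mat_def using assms[OF that]
    by (intro eq_matI) (auto simp: mat_adjoint_index complex_eq_iff)
  moreover have "1\<^sub>m (d * 1) - mat_sum (d * 1) (d * 1) (\<lambda>k. kronecker d 1 (A k) (point_tuple g c k)) {..<g}
      = 1\<^sub>m d - linear_pencil d g A c"
    by (intro eq_matI) (auto simp: mat_sum_def kronecker_def linear_pencil_def point_tuple_def mult.commute)
  ultimately show ?thesis
    by (auto simp: free_spectrahedron_def point_tuple_def)
qed

text \<open>
  The perturbation changes the form \<open>1 - \<Sum> c\<^sub>k A\<^sub>k\<close> by a multiple of a hermitian form that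
  vanishes on its kernel, and is therefore dominated by it.
\<close>

lemma pencil_kernel_perturbation:
  assumes A: "\<And>k. k < g \<Longrightarrow> A k \<in> carrier_mat d d \<and> hermitian_mat (A k)"
    and L: "psd_mat d (1\<^sub>m d - linear_pencil d g A c)"
    and a: "\<And>k. k < g \<Longrightarrow> Im (a k) = 0"
    and ker: "\<And>w u. (\<And>u. sform d (1\<^sub>m d - linear_pencil d g A c) u w = 0) \<Longrightarrow>
      sform d (linear_pencil d g A a) u w = 0"
  obtains \<epsilon> :: real where "0 < \<epsilon>"
    "psd_mat d (1\<^sub>m d - linear_pencil d g A (\<lambda>k. c k + of_real \<epsilon> * a k))"
    "psd_mat d (1\<^sub>m d - linear_pencil d g A (\<lambda>k. c k - of_real \<epsilon> * a k))"
proof -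
  let ?L = "1\<^sub>m d - linear_pencil d g A c" and ?N = "linear_pencil d g A a"
  have carr: "linear_pencil d g A x \<in> carrier_mat d d" for x by (simp add: linear_pencil_def)
  have herm: "sform d ?N v u = cnj (sform d ?N u v)" for u v
  proof -
    have "cnj (a k * sform d (A k) u v) = a k * sform d (A k) v u" if "k < g" for k
      using a[OF that] hermitian_form[of "A k" d v u] A[OF that] by (simp add: complex_eq_iff)
    then show ?thesis by (simp add: sform_linear_pencil)
  qed
  obtain C where C: "0 \<le> C" "\<And>v. cmod (sform d ?N v v) \<le> C * Re (sform d ?L v v)"
    using form_dominated[OF L herm ker] by blast
  define \<epsilon> where "\<epsilon> = 1 / (C + 1)"
  have \<epsilon>: "0 < \<epsilon>" "\<epsilon> * C \<le> 1" using C(1) by (auto simp: \<epsilon>_def field_simps)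
  have psd: "psd_mat d (1\<^sub>m d - linear_pencil d g A (\<lambda>k. c k + of_real t * a k))" if t: "\<bar>t\<bar> = \<epsilon>" for t
    unfolding psd_mat_iff
  proof (intro conjI allI)
    show "1\<^sub>m d - linear_pencil d g A (\<lambda>k. c k + of_real t * a k) \<in> carrier_mat d d"
      by (rule minus_carrier_mat[OF carr])
    fix v :: "nat \<Rightarrow> complex"
    have eq: "sform d (1\<^sub>m d - linear_pencil d g A (\<lambda>k. c k + of_real t * a k)) v v
        = sform d ?L v v - of_real t * sform d ?N v v"
      by (simp add: sform_one_minus[OF carr] sform_linear_pencil distrib_right sum.distrib
          sum_distrib_left mult.assoc)
    have pos: "0 \<le> sform d ?L v v" using L by (simp add: psd_mat_iff)
    have "\<bar>t * Re (sform d ?N v v)\<bar> \<le> \<epsilon> * cmod (sform d ?N v v)"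
      using t \<epsilon>(1) abs_Re_le_cmod by (simp add: abs_mult mult_left_mono)
    also have "\<dots> \<le> \<epsilon> * (C * Re (sform d ?L v v))" using C(2) \<epsilon>(1) by (simp add: mult_left_mono)
    also have "\<dots> \<le> Re (sform d ?L v v)"
      using mult_right_mono[OF \<epsilon>(2), of "Re (sform d ?L v v)"] pos
      by (simp add: less_eq_complex_def mult.assoc)
    finally have "0 \<le> Re (sform d ?L v v) - t * Re (sform d ?N v v)" by simp
    moreover have "Im (sform d ?N v v) = 0" using herm[of v v] by (simp add: complex_eq_iff)
    ultimately show "0 \<le> sform d (1\<^sub>m d - linear_pencil d g A (\<lambda>k. c k + of_real t * a k)) v v"
      unfolding eq using pos by (simp add: less_eq_complex_def)
  qed
  show ?thesis
    using that[OF \<epsilon>(1)] psd[of \<epsilon>] psd[of "- \<epsilon>"] \<epsilon>(1) by simp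
qed

text \<open>
  If \<open>w\<close> is in the kernel of the corner, then \<open>w\<close>, placed in the first component, is a null vector of the
  whole positive semidefinite matrix, hence in its kernel. The second block row of this equation is
  the claim.
\<close>

lemma off_diagonal_kills_kernel:
  assumes X: "X \<in> free_spectrahedron d g A 2"
    and w: "\<And>u. sform d (1\<^sub>m d - linear_pencil d g A (\<lambda>k. X k $$ (0, 0))) u w = 0"
  shows "sform d (linear_pencil d g A (\<lambda>k. X k $$ (1, 0))) u w = 0"
proof -
  let ?M = "1\<^sub>m (d * 2) - mat_sum (d * 2) (d * 2) (\<lambda>k. kronecker d 2 (A k) (X k)) {..<g}"
  let ?L = "1\<^sub>m d - linear_pencil d g A (\<lambda>k. X k $$ (0, 0))"
  \<comment> \<open>With the index convention of the Kronecker product, this is \<open>w\<close> tensored with the first unit vector of \<open>\<complex>\<^sup>2\<close>.\<close>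
  define V where "V j = (if j mod 2 = 0 then w (j div 2) else 0)" for j
  have V: "V (b * 2) = w b" "V (b * 2 + 1) = 0" for b
  proof -
    have "(b * 2 + 1) mod 2 \<noteq> 0" by presburger
    then show "V (b * 2) = w b" "V (b * 2 + 1) = 0" by (simp_all only: V_def if_False) simp
  qed
  have M: "psd_mat (d * 2) ?M" using X by (simp add: free_spectrahedron_def)
  have sum2: "(\<Sum>j<d*2. h j) = (\<Sum>b<d. h (b * 2) + h (b * 2 + 1))" for h :: "nat \<Rightarrow> complex"
    by (induction d) (simp_all add: add.assoc)
  have M0: "?M $$ (a * 2, b * 2) = ?L $$ (a, b)" and
    M1: "?M $$ (a * 2 + 1, b * 2) = - linear_pencil d g A (\<lambda>k. X k $$ (1, 0)) $$ (a, b)"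
    if "a < d" "b < d" for a b
  proof -
    have "Suc (a * 2) mod 2 = 1" "Suc (a * 2) div 2 = a" "Suc (a * 2) \<noteq> b * 2" by presburger+
    then show "?M $$ (a * 2, b * 2) = ?L $$ (a, b)"
      "?M $$ (a * 2 + 1, b * 2) = - linear_pencil d g A (\<lambda>k. X k $$ (1, 0)) $$ (a, b)"
      using that by (simp_all add: mat_sum_def kronecker_def linear_pencil_def mult.commute)
  qed
  have "sform (d * 2) ?M V V = sform d ?L w w"
  proof -
    have "(\<Sum>j<d*2. ?M $$ (a * 2, j) * V j) = (\<Sum>b<d. ?L $$ (a, b) * w b)" if "a < d" for a
      unfolding sum2 using that by (intro sum.cong refl) (simp only: M0[OF that] V mult_zero_right add_0_right lessThan_iff)
    then show ?thesis
      unfolding sform_def sum2[of "\<lambda>i. cnj (V i) * (\<Sum>j<d*2. ?M $$ (i, j) * V j)"]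
      by (intro sum.cong refl) (simp only: V complex_cnj_zero mult_zero_left add_0_right lessThan_iff)
  qed
  then have z: "sform (d * 2) ?M V V = 0" using w by simp
  have "(\<Sum>j<d. linear_pencil d g A (\<lambda>k. X k $$ (1, 0)) $$ (i, j) * w j) = 0" if "i < d" for i
  proof -
    have "(\<Sum>j<d*2. ?M $$ (i * 2 + 1, j) * V j) = 0"
      using that by (intro psd_null_kernel[OF M z]) simp
    then have "(\<Sum>b<d. ?M $$ (i * 2 + 1, b * 2) * w b) = 0"
      unfolding sum2 by (simp only: V mult_zero_right add_0_right)
    moreover have "(\<Sum>b<d. ?M $$ (i * 2 + 1, b * 2) * w b)
        = (\<Sum>b<d. - linear_pencil d g A (\<lambda>k. X k $$ (1, 0)) $$ (i, b) * w b)"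
      by (intro sum.cong refl) (simp only: M1[OF that] lessThan_iff)
    ultimately show ?thesis by (simp add: sum_negf)
  qed
  then show ?thesis by (simp add: sform_def)
qed

section \<open>Matrix convex combinations\<close>

lemma matrix_combination_index:
  assumes "\<And>i. i < m \<Longrightarrow> V i \<in> carrier_mat N n" "\<And>i. i < m \<Longrightarrow> F i \<in> carrier_mat N N"
    and "p < n" "q < n"
  shows "matrix_combination n m V F $$ (p, q) =
    (\<Sum>i<m. \<Sum>b<N. (\<Sum>a<N. cnj (V i $$ (a, p)) * F i $$ (a, b)) * V i $$ (b, q))"
proof -
  have "(mat_adjoint (V i) * F i * V i) $$ (p, q)
      = (\<Sum>b<N. (\<Sum>a<N. cnj (V i $$ (a, p)) * F i $$ (a, b)) * V i $$ (b, q))" if "i < m" for i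
    using assms(1)[OF that] assms(2)[OF that] assms(3,4)
    by (simp add: scalar_prod_def atLeast0LessThan mat_adjoint_index)
  then show ?thesis using assms(3,4) by (simp add: matrix_combination_def mat_sum_def)
qed

lemma matrix_combination_dim [simp]:
  "dim_row (matrix_combination n m V F) = n" "dim_col (matrix_combination n m V F) = n"
  by (simp_all add: matrix_combination_def mat_sum_def)

lemma corner_combination:
  assumes M: "M \<in> carrier_mat 2 2"
  shows "matrix_combination 1 1 (\<lambda>_. mat 2 1 (\<lambda>(i, j). if i = 0 then 1 else 0)) (\<lambda>_. M) = mat 1 1 (\<lambda>_. M $$ (0, 0))"
  by (intro eq_matI; (subst matrix_combination_index[where N = 2])?)
    (use M in \<open>auto simp: numeral_2_eq_2\<close>)

lemma flip_combination:
  assumes M: "M \<in> carrier_mat 2 2"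
  shows "matrix_combination 2 1 (\<lambda>_. mat 2 2 (\<lambda>(i, j). if i = j then if i = 0 then 1 else - 1 else 0)) (\<lambda>_. M)
    = mat 2 2 (\<lambda>(i, j). if i = j then M $$ (i, j) else - M $$ (i, j))"
  by (intro eq_matI; (subst matrix_combination_index[where N = 2])?)
    (use M in \<open>auto simp: numeral_2_eq_2 less_Suc_eq\<close>)

lemma midpoint_combination:
  assumes F: "F 0 \<in> carrier_mat 1 1" "F 1 \<in> carrier_mat 1 1"
  shows "matrix_combination 1 2 (\<lambda>_. mat 1 1 (\<lambda>_. complex_of_real (1 / sqrt 2))) F
    = mat 1 1 (\<lambda>_. (F 0 $$ (0, 0) + F 1 $$ (0, 0)) / 2)"
proof -
  have h: "complex_of_real (1 / sqrt 2) * z * complex_of_real (1 / sqrt 2) = z / 2" for z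
  proof -
    have "complex_of_real (1 / sqrt 2) * complex_of_real (1 / sqrt 2) = 1 / 2"
      by (simp only: of_real_mult[symmetric]) simp
    then show ?thesis by (simp add: mult_ac)
  qed
  have F': "F i \<in> carrier_mat 1 1" if "i < 2" for i using F that by (auto simp: less_2_cases_iff)
  show ?thesis
  proof (rule eq_matI)
    fix i j assume "i < dim_row (mat 1 1 (\<lambda>_. (F 0 $$ (0, 0) + F 1 $$ (0, 0)) / 2))"
      "j < dim_col (mat 1 1 (\<lambda>_. (F 0 $$ (0, 0) + F 1 $$ (0, 0)) / 2))"
    then have ij: "i = 0" "j = 0" by auto
    have "matrix_combination 1 2 (\<lambda>_. mat 1 1 (\<lambda>_. complex_of_real (1 / sqrt 2))) F $$ (0, 0) = (\<Sum>i<2. F i $$ (0, 0) / 2)"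
      by (subst matrix_combination_index[where N = 1]) (use F' in \<open>simp_all add: h del: of_real_divide\<close>)
    then show "matrix_combination 1 2 (\<lambda>_. mat 1 1 (\<lambda>_. complex_of_real (1 / sqrt 2))) F $$ (i, j)
        = mat 1 1 (\<lambda>_. (F 0 $$ (0, 0) + F 1 $$ (0, 0)) / 2) $$ (i, j)"
      by (simp add: ij numeral_2_eq_2 add_divide_distrib)
  qed simp_all
qed

lemma combination_units:
  "mat_sum 1 1 (\<lambda>i. mat_adjoint (mat 2 1 (\<lambda>(i, j). if i = 0 then 1 else 0)) * mat 2 1 (\<lambda>(i, j). if i = 0 then 1 else 0)) {..<1} = 1\<^sub>m 1"
  "mat_sum 2 2 (\<lambda>i. mat_adjoint (mat 2 2 (\<lambda>(i, j). if i = j then if i = 0 then 1 else - 1 else 0))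
     * mat 2 2 (\<lambda>(i, j). if i = j then if i = 0 then 1 else - 1 else 0)) {..<1} = 1\<^sub>m 2"
  "mat_sum 1 1 (\<lambda>i. mat_adjoint (mat 1 1 (\<lambda>_. complex_of_real (1 / sqrt 2)))
     * mat 1 1 (\<lambda>_. complex_of_real (1 / sqrt 2))) {..<2} = 1\<^sub>m 1"
proof -
  show "mat_sum 1 1 (\<lambda>i. mat_adjoint (mat 2 1 (\<lambda>(i, j). if i = 0 then 1 else 0)) * mat 2 1 (\<lambda>(i, j). if i = 0 then 1 else 0)) {..<1} = 1\<^sub>m 1"
    by (intro eq_matI) (auto simp: mat_sum_def scalar_prod_def mat_adjoint_index numeral_2_eq_2)
  show "mat_sum 2 2 (\<lambda>i. mat_adjoint (mat 2 2 (\<lambda>(i, j). if i = j then if i = 0 then 1 else - 1 else 0))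
     * mat 2 2 (\<lambda>(i, j). if i = j then if i = 0 then 1 else - 1 else 0)) {..<1} = 1\<^sub>m 2"
    by (intro eq_matI) (auto simp: mat_sum_def scalar_prod_def mat_adjoint_index numeral_2_eq_2 less_Suc_eq)
  show "mat_sum 1 1 (\<lambda>i. mat_adjoint (mat 1 1 (\<lambda>_. complex_of_real (1 / sqrt 2)))
     * mat 1 1 (\<lambda>_. complex_of_real (1 / sqrt 2))) {..<2} = 1\<^sub>m 1"
  proof -
    have "complex_of_real (sqrt 2) * complex_of_real (sqrt 2) = 2"
      by (simp only: of_real_mult[symmetric]) simp
    then show ?thesis
      by (intro eq_matI) (auto simp: mat_sum_def scalar_prod_def mat_adjoint_index)
  qed
qed

section \<open>Dilations of pure states\<close>

lemma spectrahedron_carrier: "X \<in> free_spectrahedron d g A n \<Longrightarrow> k < g \<Longrightarrow> X k \<in> carrier_mat n n"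
  by (auto simp: free_spectrahedron_def)

lemma matrix_states_carrier: "\<psi> \<in> matrix_states S n \<Longrightarrow> x \<in> S \<Longrightarrow> \<psi> x \<in> carrier_mat n n"
  by (auto simp: matrix_states_def)

lemma mat_1_eq: "M \<in> carrier_mat 1 1 \<Longrightarrow> mat 1 1 (\<lambda>_. M $$ (0, 0)) = M"
  by (intro eq_matI) auto

locale spectrahedral_matrix_states =
  fixes S :: "'b::unital_cstar_algebra set" and d g :: nat and A :: "nat \<Rightarrow> complex mat"
    and \<theta> :: "nat \<Rightarrow> ('b \<Rightarrow> complex mat) \<Rightarrow> nat \<Rightarrow> complex mat"
  assumes S: "operator_system S"
    and A: "\<And>k. k < g \<Longrightarrow> A k \<in> carrier_mat d d \<and> hermitian_mat (A k)"
    and \<theta>_bij: "\<And>n. 1 \<le> n \<Longrightarrow> bij_betw (\<theta> n) (matrix_states S n) (free_spectrahedron d g A n)"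
    and \<theta>_combination: "\<And>n m N \<psi> v. 1 \<le> n \<Longrightarrow>
      (\<And>i. i < m \<Longrightarrow> 1 \<le> N i \<and> \<psi> i \<in> matrix_states S (N i) \<and> v i \<in> carrier_mat (N i) n) \<Longrightarrow>
      mat_sum n n (\<lambda>i. mat_adjoint (v i) * v i) {..<m} = 1\<^sub>m n \<Longrightarrow>
      \<theta> n (\<lambda>x\<in>S. matrix_combination n m v (\<lambda>i. \<psi> i x)) =
        (\<lambda>k\<in>{..<g}. matrix_combination n m v (\<lambda>i. \<theta> (N i) (\<psi> i) k))"
begin

lemma \<theta>_mem: "1 \<le> n \<Longrightarrow> \<psi> \<in> matrix_states S n \<Longrightarrow> \<theta> n \<psi> \<in> free_spectrahedron d g A n"
  using \<theta>_bij bij_betwE by blast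

lemma \<theta>_inj: "1 \<le> n \<Longrightarrow> \<psi> \<in> matrix_states S n \<Longrightarrow> \<psi>' \<in> matrix_states S n \<Longrightarrow> \<theta> n \<psi> = \<theta> n \<psi>' \<Longrightarrow> \<psi> = \<psi>'"
  using \<theta>_bij bij_betw_imp_inj_on inj_onD by metis

lemma \<theta>_surj:
  assumes "1 \<le> n" "X \<in> free_spectrahedron d g A n"
  obtains \<psi> where "\<psi> \<in> matrix_states S n" "\<theta> n \<psi> = X"
proof -
  have "X \<in> \<theta> n ` matrix_states S n"
    using assms(2) unfolding bij_betw_imp_surj_on[OF \<theta>_bij[OF assms(1)]] .
  then show ?thesis using that by (elim imageE) simp
qed

text \<open>
  Compression by the first unit vector of \<open>\<complex>\<^sup>2\<close> is a matrix convex combination with one summand.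
\<close>

lemma corner_point:
  assumes \<psi>: "\<psi> \<in> matrix_states S 2" and corner: "\<And>x. x \<in> S \<Longrightarrow> \<psi> x $$ (0, 0) = \<omega> x"
  shows "\<theta> 1 (\<lambda>x\<in>S. mat 1 1 (\<lambda>_. \<omega> x)) = point_tuple g (\<lambda>k. \<theta> 2 \<psi> k $$ (0, 0))"
proof -
  let ?v = "\<lambda>_::nat. mat 2 1 (\<lambda>(i, j). if i = 0 then 1 else 0) :: complex mat"
  have "\<theta> 1 (\<lambda>x\<in>S. matrix_combination 1 1 ?v (\<lambda>_. \<psi> x))
      = (\<lambda>k\<in>{..<g}. matrix_combination 1 1 ?v (\<lambda>_. \<theta> 2 \<psi> k))"
    using \<psi> combination_units(1) by (intro \<theta>_combination[where N = "\<lambda>_. 2" and \<psi> = "\<lambda>_. \<psi>"]) auto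
  moreover have "(\<lambda>x\<in>S. matrix_combination 1 1 ?v (\<lambda>_. \<psi> x)) = (\<lambda>x\<in>S. mat 1 1 (\<lambda>_. \<omega> x))"
    using corner corner_combination[OF matrix_states_carrier[OF \<psi>]] by (intro restrict_ext) simp
  moreover have "(\<lambda>k\<in>{..<g}. matrix_combination 1 1 ?v (\<lambda>_. \<theta> 2 \<psi> k)) = point_tuple g (\<lambda>k. \<theta> 2 \<psi> k $$ (0, 0))"
    unfolding point_tuple_def using corner_combination[OF spectrahedron_carrier[OF \<theta>_mem[OF _ \<psi>]]]
    by (intro restrict_ext) simp
  ultimately show ?thesis by simp
qed

text \<open>
  The points \<open>p\<close> and \<open>q\<close> come from states on \<open>S\<close>, whose midpoint is mapped to the same point as \<open>\<omega>\<close> and is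
  therefore \<open>\<omega>\<close>.
\<close>

lemma pure_state_extreme:
  assumes \<omega>: "\<omega> \<in> pure_states S"
    and c: "\<theta> 1 (\<lambda>x\<in>S. mat 1 1 (\<lambda>_. \<omega> x)) = point_tuple g c"
    and p: "point_tuple g p \<in> free_spectrahedron d g A 1" and q: "point_tuple g q \<in> free_spectrahedron d g A 1"
    and mid: "\<And>k. k < g \<Longrightarrow> (p k + q k) / 2 = c k" and k: "k < g"
  shows "p k = c k"
proof -
  have \<omega>S: "\<omega> \<in> states S" using \<omega> by (simp add: pure_states_def)
  let ?m = "\<lambda>f. \<lambda>x\<in>S. mat 1 1 (\<lambda>_. f x :: complex)"
  obtain \<psi> where \<psi>: "\<psi> \<in> matrix_states S 1" "\<theta> 1 \<psi> = point_tuple g p" using \<theta>_surj[OF _ p] by auto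
  obtain \<psi>' where \<psi>': "\<psi>' \<in> matrix_states S 1" "\<theta> 1 \<psi>' = point_tuple g q" using \<theta>_surj[OF _ q] by auto
  define f where "f = (\<lambda>x\<in>S. \<psi> x $$ (0, 0))"
  define f' where "f' = (\<lambda>x\<in>S. \<psi>' x $$ (0, 0))"
  define h where "h = (\<lambda>x\<in>S. (f x + f' x) / 2)"
  have f: "f \<in> states S" "f' \<in> states S"
    using matrix_state_state[OF S] \<psi>(1) \<psi>'(1) by (simp_all add: f_def f'_def)
  note fD = statesD[OF f(1)] and f'D = statesD[OF f(2)]
  have h: "h \<in> states S"
  proof -
    have "cmod ((f x + f' x) / 2) \<le> norm x" if "x \<in> S" for x
      using norm_triangle_ineq[of "f x" "f' x"] fD(4)[OF that] f'D(4)[OF that] by (simp add: norm_divide)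
    then show ?thesis
      using fD(1-3) f'D(1-3) operator_systemD[OF S]
      by (simp add: states_def h_def add_divide_distrib distrib_left)
  qed
  let ?\<Psi> = "\<lambda>i::nat. if i = 0 then \<psi> else \<psi>'" and ?v = "\<lambda>_::nat. mat 1 1 (\<lambda>_. complex_of_real (1 / sqrt 2))"
  have "\<theta> 1 (\<lambda>x\<in>S. matrix_combination 1 2 ?v (\<lambda>i. ?\<Psi> i x))
      = (\<lambda>k\<in>{..<g}. matrix_combination 1 2 ?v (\<lambda>i. \<theta> 1 (?\<Psi> i) k))"
    using \<psi>(1) \<psi>'(1) combination_units(3) by (intro \<theta>_combination[where N = "\<lambda>_. 1"]) auto
  moreover have "(\<lambda>x\<in>S. matrix_combination 1 2 ?v (\<lambda>i. ?\<Psi> i x)) = ?m h"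
    using matrix_states_carrier[OF \<psi>(1)] matrix_states_carrier[OF \<psi>'(1)]
    by (intro restrict_ext) (subst midpoint_combination, auto simp: h_def f_def f'_def)
  moreover have "(\<lambda>k\<in>{..<g}. matrix_combination 1 2 ?v (\<lambda>i. \<theta> 1 (?\<Psi> i) k)) = point_tuple g c"
    unfolding point_tuple_def[of g c]
    using spectrahedron_carrier[OF p] spectrahedron_carrier[OF q] mid
    by (intro restrict_ext) (subst midpoint_combination, auto simp: \<psi>(2)[simplified] \<psi>'(2)[simplified], auto simp: point_tuple_def)
  ultimately have "\<theta> 1 (?m h) = \<theta> 1 (?m \<omega>)" using c by simp
  then have m_eq: "?m h = ?m \<omega>"
    using state_matrix_state[OF S h] state_matrix_state[OF S \<omega>S] by (intro \<theta>_inj) auto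
  have "mat 1 1 (\<lambda>_. h x) = mat 1 1 (\<lambda>_. \<omega> x)" if "x \<in> S" for x
    using fun_cong[OF m_eq, of x] that by simp
  then have "mat 1 1 (\<lambda>_. h x) $$ (0, 0) = mat 1 1 (\<lambda>_. \<omega> x) $$ (0, 0)" if "x \<in> S" for x
    using that by metis
  then have "h x = \<omega> x" if "x \<in> S" for x using that by simp
  then have half: "\<forall>x\<in>S. \<omega> x = complex_of_real (1 - 1/2) * f x + complex_of_real (1/2) * f' x"
    by (auto simp: h_def add_divide_distrib)
  have "f1 = \<omega>" if "f1 \<in> states S" "f2 \<in> states S" "0 < t" "t < 1"
    "\<forall>x\<in>S. \<omega> x = complex_of_real (1 - t) * f1 x + complex_of_real t * f2 x" for f1 f2 and t :: real
    using \<omega> that unfolding pure_states_def by blast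
  from this[OF f _ _ half] have "f = \<omega>" by simp
  then have "\<psi> = ?m \<omega>"
    using \<psi>(1) mat_1_eq[OF matrix_states_carrier[OF \<psi>(1)]]
    by (intro ext) (auto simp: f_def matrix_states_def restrict_def PiE_def extensional_def)
  then have "point_tuple g p = point_tuple g c" using c \<psi>(2) by simp
  then have "point_tuple g p k $$ (0, 0) = point_tuple g c k $$ (0, 0)" by simp
  then show ?thesis using k by (simp add: point_tuple_def)
qed

text \<open>
  In terms of the GNS representation of \<open>\<phi>\<close>: the vector of \<open>y\<close> is orthogonal to \<open>x\<close> applied to the cyclic
  vector. So each \<open>x \<in> S\<close> has the cyclic vector as an eigenvector.
\<close>

lemma pure_state_dilation_trivial:
  assumes conj: "conj_tuple g ` free_spectrahedron d g A 2 = free_spectrahedron d g A 2"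
    and \<omega>: "\<omega> \<in> pure_states S" and ext: "state_extension S \<omega> \<phi>"
    and y: "\<phi> y = 0" "\<phi> (star y * y) = 1" and x: "x \<in> S"
  shows "\<phi> (star y * x) = 0"
proof -
  have \<phi>: "\<phi> \<in> states UNIV" using ext by (simp add: state_extension_def)
  define C where "C z = (\<lambda>x\<in>S. vector_compression \<phi> 2 (\<lambda>p. if p = 0 then 1 else z) x)" for z
  have C: "C z \<in> matrix_states S 2" if "\<phi> z = 0" "\<phi> (star z * z) = 1" for z
    unfolding C_def using that
    by (intro vector_compression_matrix_state[OF S \<phi>]) (auto simp: state_one[OF \<phi>] state_star[OF \<phi>])
  define \<psi> where "\<psi> = C y"
  have \<psi>: "\<psi> \<in> matrix_states S 2" unfolding \<psi>_def by (rule C[OF y])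
  have corner: "\<psi> x $$ (0, 0) = \<omega> x" if "x \<in> S" for x
    using ext that by (simp add: \<psi>_def C_def vector_compression_def state_extension_def)
  define X where "X = \<theta> 2 \<psi>"
  define c where "c = (\<lambda>k. X k $$ (0, 0))"
  define b where "b = (\<lambda>k. X k $$ (1, 0))"
  have X: "X \<in> free_spectrahedron d g A 2" unfolding X_def using \<psi> by (intro \<theta>_mem) auto
  note XC = spectrahedron_carrier[OF X]
  have X_herm: "cnj (X k $$ (i, j)) = X k $$ (j, i)" if "k < g" "i < 2" "j < 2" for k i j
    using X XC[OF that(1)] that by (intro hermitian_mat_index[of _ 2]) (auto simp: free_spectrahedron_def)
  have c: "\<theta> 1 (\<lambda>x\<in>S. mat 1 1 (\<lambda>_. \<omega> x)) = point_tuple g c"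
    unfolding c_def X_def by (rule corner_point[OF \<psi> corner])
  have \<omega>S: "\<omega> \<in> states S" using \<omega> by (simp add: pure_states_def)
  have c_real: "Im (c k) = 0" if "k < g" for k
    using X_herm[OF that, of 0 0] by (simp add: c_def complex_eq_iff)
  have "point_tuple g c \<in> free_spectrahedron d g A 1"
    using \<theta>_mem[OF _ state_matrix_state[OF S \<omega>S]] c by simp
  then have L: "psd_mat d (1\<^sub>m d - linear_pencil d g A c)"
    using point_tuple_in_spectrahedron[of g c d A, OF c_real] by simp
  \<comment> \<open>Conjugation fixes the real corner \<open>c\<close> and conjugates the off-diagonal part \<open>b\<close>.\<close>
  let ?Y = "conj_tuple g X"
  have Y: "?Y \<in> free_spectrahedron d g A 2" using conj X by blast
  have Y_index: "?Y k $$ (i, j) = cnj (X k $$ (i, j))" if "k < g" "i < 2" "j < 2" for k i j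
    using XC[OF that(1)] that by (simp add: conj_tuple_def)
  have pencil_cong: "linear_pencil d g A p = linear_pencil d g A q" if "\<And>k. k < g \<Longrightarrow> p k = q k" for p q
    using that by (simp add: linear_pencil_def cong: sum.cong_simp)
  have Yc: "linear_pencil d g A (\<lambda>k. ?Y k $$ (0, 0)) = linear_pencil d g A c"
    and Yb: "linear_pencil d g A (\<lambda>k. ?Y k $$ (1, 0)) = linear_pencil d g A (\<lambda>k. cnj (b k))"
    by (rule pencil_cong; use c_real in \<open>simp add: Y_index c_def b_def complex_eq_iff\<close>)+
  \<comment> \<open>Extremality of \<open>c\<close> leaves no real direction that kills the kernel.\<close>
  have real_direction_zero: "a k = 0"
    if a: "\<And>k. k < g \<Longrightarrow> Im (a k) = 0" and k: "k < g"
      and ker: "\<And>w u. (\<And>u. sform d (1\<^sub>m d - linear_pencil d g A c) u w = 0) \<Longrightarrow> sform d (linear_pencil d g A a) u w = 0"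
    for a k
  proof -
    obtain \<epsilon> where \<epsilon>: "0 < \<epsilon>"
      "psd_mat d (1\<^sub>m d - linear_pencil d g A (\<lambda>k. c k + of_real \<epsilon> * a k))"
      "psd_mat d (1\<^sub>m d - linear_pencil d g A (\<lambda>k. c k - of_real \<epsilon> * a k))"
      using pencil_kernel_perturbation[OF A L a ker] by blast
    have "point_tuple g (\<lambda>k. c k + of_real \<epsilon> * a k) \<in> free_spectrahedron d g A 1"
      "point_tuple g (\<lambda>k. c k - of_real \<epsilon> * a k) \<in> free_spectrahedron d g A 1"
      using \<epsilon>(2,3) point_tuple_in_spectrahedron[of g "\<lambda>k. c k + of_real \<epsilon> * a k" d A]
        point_tuple_in_spectrahedron[of g "\<lambda>k. c k - of_real \<epsilon> * a k" d A]
      by (simp_all add: a c_real)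
    from pure_state_extreme[OF \<omega> c this _ k] have "c k + of_real \<epsilon> * a k = c k" by simp
    then show ?thesis using \<epsilon>(1) by simp
  qed
  have ker: "sform d (linear_pencil d g A b) u w = 0 \<and> sform d (linear_pencil d g A (\<lambda>k. cnj (b k))) u w = 0"
    if w: "\<And>u. sform d (1\<^sub>m d - linear_pencil d g A c) u w = 0" for w u
  proof
    show "sform d (linear_pencil d g A b) u w = 0"
      by (rule off_diagonal_kills_kernel[OF X, folded c_def b_def, OF w])
    show "sform d (linear_pencil d g A (\<lambda>k. cnj (b k))) u w = 0"
      by (rule off_diagonal_kills_kernel[OF Y, unfolded Yc Yb, OF w])
  qed
  have re: "complex_of_real (Re z) = (1/2) * z + (1/2) * cnj z"
    and im: "complex_of_real (Im z) = (- \<i>/2) * z + (\<i>/2) * cnj z" for z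
    by (simp_all add: complex_eq_iff)
  have comb: "sform d (linear_pencil d g A (\<lambda>k. s * b k + t * cnj (b k))) u w
      = s * sform d (linear_pencil d g A b) u w + t * sform d (linear_pencil d g A (\<lambda>k. cnj (b k))) u w" for s t u w
    by (simp add: sform_linear_pencil sum_distrib_left distrib_right sum.distrib mult.assoc)
  have "complex_of_real (Re (b k)) = 0" if "k < g" for k
  proof (rule real_direction_zero[of "\<lambda>k. of_real (Re (b k))", OF _ that])
    fix w u assume w: "\<And>u. sform d (1\<^sub>m d - linear_pencil d g A c) u w = 0"
    show "sform d (linear_pencil d g A (\<lambda>k. of_real (Re (b k)))) u w = 0"
      unfolding re comb using ker[OF w, of u] by simp
  qed simp
  moreover have "complex_of_real (Im (b k)) = 0" if "k < g" for k
  proof (rule real_direction_zero[of "\<lambda>k. of_real (Im (b k))", OF _ that])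
    fix w u assume w: "\<And>u. sform d (1\<^sub>m d - linear_pencil d g A c) u w = 0"
    show "sform d (linear_pencil d g A (\<lambda>k. of_real (Im (b k)))) u w = 0"
      unfolding im comb using ker[OF w, of u] by simp
  qed simp
  ultimately have b0: "X k $$ (1, 0) = 0" if "k < g" for k
    using that by (simp add: b_def complex_eq_iff)
  then have b0': "X k $$ (0, 1) = 0" if "k < g" for k
    using X_herm[OF that, of 1 0] that by simp
  let ?v = "\<lambda>_::nat. mat 2 2 (\<lambda>(i, j). if i = j then if i = 0 then 1 else - 1 else 0) :: complex mat"
  \<comment> \<open>Conjugating by \<open>diag(1, -1)\<close> amounts to replacing \<open>y\<close> by \<open>- y\<close>.\<close>
  have flip: "(\<lambda>x\<in>S. matrix_combination 2 1 ?v (\<lambda>_. \<psi> x)) = C (- y)"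
    unfolding C_def
  proof (rule restrict_ext)
    fix x assume "x \<in> S"
    then show "matrix_combination 2 1 ?v (\<lambda>_. \<psi> x) = vector_compression \<phi> 2 (\<lambda>p. if p = 0 then 1 else - y) x"
      unfolding flip_combination[OF matrix_states_carrier[OF \<psi> \<open>x \<in> S\<close>]]
      by (intro eq_matI)
        (auto simp: \<psi>_def C_def vector_compression_def state_minus[OF \<phi>] less_2_cases_iff)
  qed
  have "\<theta> 2 (C (- y)) = (\<lambda>k\<in>{..<g}. matrix_combination 2 1 ?v (\<lambda>_. X k))"
    unfolding X_def flip[symmetric]
    using \<psi> combination_units(2) by (intro \<theta>_combination[where N = "\<lambda>_. 2" and \<psi> = "\<lambda>_. \<psi>"]) auto
  also have "\<dots> = X"
  proof
    fix k
    show "(\<lambda>k\<in>{..<g}. matrix_combination 2 1 ?v (\<lambda>_. X k)) k = X k"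
    proof (cases "k < g")
      case True
      have "mat 2 2 (\<lambda>(i, j). if i = j then X k $$ (i, j) else - X k $$ (i, j)) = X k"
        using XC[OF True] b0[OF True] b0'[OF True] by (intro eq_matI) (auto simp: less_2_cases_iff)
      then show ?thesis using True flip_combination[OF XC[OF True]] by simp
    next
      case False
      then show ?thesis using X by (auto simp: free_spectrahedron_def PiE_def extensional_def)
    qed
  qed
  finally have "\<theta> 2 (C (- y)) = \<theta> 2 (C y)" by (simp add: X_def \<psi>_def)
  moreover have "C (- y) \<in> matrix_states S 2" "C y \<in> matrix_states S 2"
    using y by (auto intro!: C simp: state_minus[OF \<phi>])
  ultimately have "C (- y) = C y" by (intro \<theta>_inj) auto
  then have "C (- y) x $$ (1, 0) = C y x $$ (1, 0)" by simp
  then show ?thesis using x by (simp add: C_def vector_compression_def state_minus[OF \<phi>])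
qed

end

section \<open>Multiplicativity and uniqueness of the extension\<close>

lemma generated_cstar_induct:
  assumes "generated_cstar S = UNIV" "cstar_subalgebra D" "S \<subseteq> D"
  shows "x \<in> D"
  using assms unfolding generated_cstar_def by blast

lemma state_continuous:
  assumes \<phi>: "\<phi> \<in> states UNIV" shows "continuous_on UNIV \<phi>"
proof -
  have "dist (\<phi> x) (\<phi> y) \<le> dist x y" for x y
    using state_bound[OF \<phi>, of "x - y"] by (simp add: dist_norm state_diff[OF \<phi>])
  then show ?thesis unfolding continuous_on_iff by (meson le_less_trans)
qed

text \<open>
  The Cauchy-Schwarz inequality for \<open>\<phi>\<close>, obtained from the positivity of the compression of the unit to
  the vectors of \<open>y\<close> and \<open>x\<close>.
\<close>

lemma state_null_vector:
  assumes \<phi>: "\<phi> \<in> states UNIV" and y: "\<phi> (star y * y) = 0" shows "\<phi> (star y * x) = 0"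
proof -
  let ?M = "amplification 1 2 (vector_compression \<phi> 2 (\<lambda>p. if p = 0 then y else x)) (mat 1 1 (\<lambda>_. 1))"
  have "positive_mat 1 (mat 1 1 (\<lambda>_. 1 :: 'a))"
    unfolding positive_mat_def
    by (intro bexI[of _ "mat 1 1 (\<lambda>_. 1)"] eq_matI) (auto simp: star_mat_def scalar_prod_def)
  then have M: "psd_mat 2 ?M" using amplified_compression_psd[OF \<phi>, of 1 _ 2] by simp
  have "sform 2 ?M (unit_fun 0) (unit_fun 0) = 0"
    using y by (simp add: sform_def amplification_def vector_compression_def numeral_2_eq_2)
  then have "sform 2 ?M (unit_fun 1) (unit_fun 0) = 0" by (rule psd_null_vector[OF M])
  then have "\<phi> (star x * y) = 0"
    by (simp add: sform_def amplification_def vector_compression_def numeral_2_eq_2)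
  then show ?thesis using state_star[OF \<phi>, of "star x * y"] by (simp add: star_mult star_star)
qed

text \<open>
  Apply the orthogonality to \<open>y = z\<^sup>* - \<phi> (z\<^sup>*) 1\<close>, after normalizing it, to see that \<open>x \<in> S\<close> splits off
  from every product \<open>z x\<close>.
\<close>

lemma state_multiplicative:
  assumes S: "operator_system S" "generated_cstar S = UNIV" and \<phi>: "\<phi> \<in> states UNIV"
    and orth: "\<And>x y. x \<in> S \<Longrightarrow> \<phi> y = 0 \<Longrightarrow> \<phi> (star y * y) = 1 \<Longrightarrow> \<phi> (star y * x) = 0"
  shows "\<phi> (z * x) = \<phi> z * \<phi> x"
proof -
  note lin = state_add[OF \<phi>] state_scaleC[OF \<phi>] state_diff[OF \<phi>] state_star[OF \<phi>] state_one[OF \<phi>] state_zero[OF \<phi>]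
  have orth': "\<phi> (star y * x) = 0" if "x \<in> S" "\<phi> y = 0" for x y
  proof (cases "\<phi> (star y * y) = 0")
    case True then show ?thesis by (rule state_null_vector[OF \<phi>])
  next
    case False
    define t where "t = Re (\<phi> (star y * y))"
    have t: "\<phi> (star y * y) = of_real t" "0 < t"
      using False state_nonneg[OF \<phi>, of y] by (auto simp: t_def less_eq_complex_def complex_eq_iff)
    let ?y = "complex_of_real (1 / sqrt t) *\<^sub>C y"
    have "\<phi> (star ?y * ?y) = of_real (1 / sqrt t) * (of_real (1 / sqrt t) * of_real t)"
      by (simp add: star_scaleC mult_scaleC_left mult_scaleC_right lin t)
    also have "\<dots> = of_real (1 / sqrt t * (1 / sqrt t * t))" by (simp only: of_real_mult)
    also have "1 / sqrt t * (1 / sqrt t * t) = 1" using t by (simp add: field_simps)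
    finally have "\<phi> (star ?y * x) = 0" using that by (intro orth) (simp_all add: lin)
    then show ?thesis using t by (simp add: star_scaleC mult_scaleC_left lin)
  qed
  have mult_S: "\<phi> (z * x) = \<phi> z * \<phi> x" if "x \<in> S" for z x
  proof -
    let ?y = "star z - \<phi> (star z) *\<^sub>C 1"
    have "\<phi> (star ?y * x) = 0" using that by (intro orth') (simp_all add: lin)
    moreover have "star ?y * x = z * x - \<phi> z *\<^sub>C x"
      by (simp add: star_diff star_star star_scaleC lin left_diff_distrib mult_scaleC_left)
    ultimately show ?thesis by (simp add: lin)
  qed
  \<comment> \<open>The second condition makes \<open>D\<close> closed under \<open>star\<close>.\<close>
  define D where "D = {x. (\<forall>z. \<phi> (z * x) = \<phi> z * \<phi> x) \<and> (\<forall>z. \<phi> (z * star x) = \<phi> z * \<phi> (star x))}"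
  have "cstar_subalgebra D"
    unfolding cstar_subalgebra_def complex_subspace_def
  proof (intro conjI ballI allI)
    show "closed D"
    proof -
      have cont: "continuous_on UNIV (\<lambda>x. \<phi> (f x))" if "continuous_on UNIV f" for f :: "'a \<Rightarrow> 'a"
        using continuous_on_compose2[OF state_continuous[OF \<phi>] that] by simp
      have "continuous_on UNIV (star :: 'a \<Rightarrow> 'a)"
        unfolding continuous_on_def by (auto intro!: tendsto_star tendsto_intros)
      then show ?thesis unfolding D_def Collect_conj_eq Collect_all_eq
        by (intro closed_Int closed_INT ballI closed_Collect_eq cont continuous_intros)
    qed
    show "x * y \<in> D" if "x \<in> D" "y \<in> D" for x y
      using that by (simp add: D_def star_mult mult.assoc[symmetric] del: state_star)
  qed (auto simp: D_def distrib_left distrib_right lin star_add star_star star_scaleC mult_scaleC_right)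
  moreover have "S \<subseteq> D" using mult_S operator_systemD(4)[OF S(1)] by (auto simp: D_def)
  ultimately have "x \<in> D" by (rule generated_cstar_induct[OF S(2)])
  then show ?thesis by (simp add: D_def)
qed

lemma multiplicative_extension_unique:
  assumes gen: "generated_cstar S = UNIV"
    and f: "f \<in> states UNIV" "\<And>x y. f (x * y) = f x * f y"
    and h: "h \<in> states UNIV" "\<And>x y. h (x * y) = h x * h y"
    and eq: "\<And>x. x \<in> S \<Longrightarrow> f x = h x"
  shows "f = h"
proof -
  have "closed {x. f x = h x}"
    using f h by (intro closed_Collect_eq state_continuous)
  then have "cstar_subalgebra {x. f x = h x}"
    by (simp add: cstar_subalgebra_def complex_subspace_def f(2) h(2) state_zero[OF f(1)] state_zero[OF h(1)]
        state_add[OF f(1)] state_add[OF h(1)] state_scaleC[OF f(1)] state_scaleC[OF h(1)]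
        state_star[OF f(1)] state_star[OF h(1)])
  then have "x \<in> {x. f x = h x}" for x
    using eq by (intro generated_cstar_induct[OF gen]) auto
  then show ?thesis by auto
qed

section \<open>Pure states of free spectrahedra extend uniquely\<close>

lemma topspace_mat_topology: "topspace (mat_topology n) = carrier_mat n n"
  by (auto simp: mat_topology_def topspace_pullback_topology)

lemma topspace_matrix_states: "topspace (matrix_states_topology S n) = matrix_states S n"
  by (auto simp: matrix_states_topology_def topspace_mat_topology matrix_states_def)

lemma topspace_free_spectrahedron: "topspace (free_spectrahedron_topology d g A n) = free_spectrahedron d g A n"
  by (auto simp: free_spectrahedron_topology_def topspace_mat_topology free_spectrahedron_def)

theorem proposition2p1:
  fixes S :: "'b::unital_cstar_algebra set"
    and d g :: nat
    and A :: "nat \<Rightarrow> complex mat"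
  assumes "operator_system S"
    and "generated_cstar S = UNIV"
    and "d \<ge> 1" and "g \<ge> 1"
    and "\<And>k. k < g \<Longrightarrow> A k \<in> carrier_mat d d \<and> hermitian_mat (A k)"
    and "matrix_state_space_is_free_spectrahedron S d g A"
    and "conj_tuple g ` free_spectrahedron d g A 2 = free_spectrahedron d g A 2"
  shows "(\<forall>\<omega>\<in>pure_states S. (\<exists>!\<phi>. state_extension S \<omega> \<phi>) \<and>
            (\<forall>\<phi>. state_extension S \<omega> \<phi> \<longrightarrow> star_representation \<phi>))
         \<and> pure_extension_property S"
proof -
  obtain \<theta> where homeo: "\<And>n. 1 \<le> n \<Longrightarrow> homeomorphic_map (matrix_states_topology S n) (free_spectrahedron_topology d g A n) (\<theta> n)"
    and comb: "\<forall>n\<ge>1. \<forall>m. \<forall>N :: nat \<Rightarrow> nat. \<forall>\<psi> v.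
           (\<forall>i<m. N i \<ge> 1 \<and> \<psi> i \<in> matrix_states S (N i) \<and> v i \<in> carrier_mat (N i) n) \<and>
           mat_sum n n (\<lambda>i. mat_adjoint (v i) * v i) {..<m} = 1\<^sub>m n
           \<longrightarrow> \<theta> n (\<lambda>x\<in>S. matrix_combination n m v (\<lambda>i. \<psi> i x)) =
               (\<lambda>k\<in>{..<g}. matrix_combination n m v (\<lambda>i. \<theta> (N i) (\<psi> i) k))"
    using assms(6) unfolding matrix_state_space_is_free_spectrahedron_def by blast
  interpret spectrahedral_matrix_states S d g A \<theta>
  proof
    show "bij_betw (\<theta> n) (matrix_states S n) (free_spectrahedron d g A n)" if "1 \<le> n" for n
      using homeo[OF that] homeomorphic_imp_surjective_map homeomorphic_imp_injective_map
      unfolding bij_betw_def topspace_matrix_states[symmetric] topspace_free_spectrahedron[symmetric] by blast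
  qed (use assms comb in auto)
  have mult: "\<phi> \<in> states UNIV \<and> (\<forall>x y. \<phi> (x * y) = \<phi> x * \<phi> y)"
    if "\<omega> \<in> pure_states S" "state_extension S \<omega> \<phi>" for \<omega> \<phi>
  proof -
    have \<phi>: "\<phi> \<in> states UNIV" using that by (simp add: state_extension_def)
    show ?thesis
      using state_multiplicative[OF assms(1,2) \<phi>] pure_state_dilation_trivial[OF assms(7) that] \<phi> by blast
  qed
  have unique: "\<exists>!\<phi>. state_extension S \<omega> \<phi>" if \<omega>: "\<omega> \<in> pure_states S" for \<omega>
  proof -
    obtain \<phi> where "state_extension S \<omega> \<phi>"
      using \<omega> state_extension_exists[OF assms(1)] by (auto simp: pure_states_def)
    moreover have "\<phi> = \<phi>'" if "state_extension S \<omega> \<phi>" "state_extension S \<omega> \<phi>'" for \<phi> \<phi>'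
      using mult[OF \<omega> that(1)] mult[OF \<omega> that(2)] that
      by (intro multiplicative_extension_unique[OF assms(2)]) (auto simp: state_extension_def)
    ultimately show ?thesis by blast
  qed
  have "star_representation \<phi>" if "\<omega> \<in> pure_states S" "state_extension S \<omega> \<phi>" for \<omega> \<phi>
  proof -
    have \<phi>: "\<phi> \<in> states UNIV" and m: "\<forall>x y. \<phi> (x * y) = \<phi> x * \<phi> y" using mult[OF that] by auto
    then show ?thesis
      by (simp add: star_representation_def state_add[OF \<phi>] state_scaleC[OF \<phi>] state_star[OF \<phi>] state_one[OF \<phi>])
  qed
  then show ?thesis using unique by (auto simp: pure_extension_property_def)
qed

end
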